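(* Let $(\Omega,\mathcal{F})$ be a standard Borel space and let $E\subset\Omega\times\Omega$ be a measurable equivalence relation. Then $$\min_{P\in M(\mu,\nu)}(1-P(E))=\|\mu-\nu\|_{\mathcal{G}_1}\quad\text{for all }\mu,\nu\in\mathcal{P}(\mathcal{F}).$$ Moreover, for all $\mu,\nu\in\mathcal{P}(\mathcal{F})$ there is $B\in\mathcal{F}$ such that $$\mu(B)=\nu(B)=1\quad\text{and}\quad\min_{P\in M(\mu,\nu)}(1-P(E))=\|\mu-\nu\|_{\mathcal{G}_B}.$$ (Here "$\min$" asserts that the infimum is achieved.)
   Context: A measurable space $(\Omega,\mathcal{F})$ is a standard Borel space if $\mathcal{F}$ is the Borel $\sigma$-field of some Polish (separable, completely metrizable) topology on $\Omega$. $\mathcal{P}(\mathcal{F})$ is the set of all ($\sigma$-additive) probability measures on $\mathcal{F}$. A measurable equivalence relation is a set $E\in\mathcal{F}\otimes\mathcal{F}$ such that the relation $x\sim y\Leftrightarrow(x,y)\in E$ is reflexive, symmetric and transitive on $\Omega$. $M(\mu,\nu)$ is the set of all finitely additive probabilities $P$ on $\mathcal{F}\otimes\mathcal{F}$ (the product $\sigma$-field) with marginals $\mu$ and $\nu$, i.e. $P(A\times\Omega)=\mu(A)$ and $P(\Omega\times A)=\nu(A)$ for all $A\in\mathcal{F}$. $\widehat{\mathcal{F}}=\bigcap_{\mu\in\mathcal{P}(\mathcal{F})}\overline{\mathcal{F}}^{\mu}$ is the universally measurable $\sigma$-field with respect to $\mathcal{F}$, where $\overline{\mathcal{F}}^{\mu}$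 is the completion of $\mathcal{F}$ with respect to $\mu$. For $\mu\in\mathcal{P}(\mathcal{F})$, the unique extension of $\mu$ to $\widehat{\mathcal{F}}$ is still denoted by $\mu$. Define $$\mathcal{G}_1=\{A\in\widehat{\mathcal{F}}:\ 1_A(x)=1_A(y)\text{ for all }(x,y)\in E\}$$ and, for $B\subset\Omega$, $$\mathcal{G}_B=\{A\in\mathcal{F}:\ 1_A(x)=1_A(y)\text{ for all }(x,y)\in E\cap(B\times B)\}.$$ For a $\sigma$-field $\mathcal{G}\subset\widehat{\mathcal{F}}$, $\|\mu-\nu\|_{\mathcal{G}}=\sup_{A\in\mathcal{G}}|\mu(A)-\nu(A)|$. *)

theory Defs
  imports "HOL-Probability.Probability"
begin

text \<open>
  Throughout, a measurable space is a value \<open>F\<close> of type \<open>'a measure\<close> of which only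
  \<open>space F\<close> and \<open>sets F\<close> matter; the set of all probability measures on it is
  \<open>space (prob_algebra F)\<close>.
\<close>

definition standard_borel :: "'a measure \<Rightarrow> bool" where
  "standard_borel F \<longleftrightarrow>
     (\<exists>T. completely_metrizable_space T \<and> separable_space T \<and>
          space F = topspace T \<and> sets F = sigma_sets (topspace T) {U. openin T U})"

definition measurable_equivalence :: "'a measure \<Rightarrow> ('a \<times> 'a) set \<Rightarrow> bool" where
  "measurable_equivalence F E \<longleftrightarrow> E \<in> sets (F \<Otimes>\<^sub>M F) \<and> equiv (space F) E"

definition fin_additive_prob :: "'b measure \<Rightarrow> ('b set \<Rightarrow> real) \<Rightarrow> bool" where
  "fin_additive_prob N P \<longleftrightarrow>
     (\<forall>A\<in>sets N. 0 \<le> P A) \<and> additive (sets N) P \<and> P (space N) = 1"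

text \<open>
  The values of \<open>P\<close> outside the product \<open>\<sigma>\<close>-field are left unconstrained; they play no role.
\<close>

definition fin_additive_couplings ::
    "'a measure \<Rightarrow> 'a measure \<Rightarrow> 'a measure \<Rightarrow> (('a \<times> 'a) set \<Rightarrow> real) set" where
  "fin_additive_couplings F \<mu> \<nu> =
     {P. fin_additive_prob (F \<Otimes>\<^sub>M F) P \<and>
         (\<forall>A\<in>sets F. P (A \<times> space F) = measure \<mu> A \<and> P (space F \<times> A) = measure \<nu> A)}"

text \<open>
  The conjunct \<open>A \<subseteq> space F\<close> matters only for empty \<open>space F\<close>, where the intersection is over
  no measures at all.
\<close>

definition universally_measurable :: "'a measure \<Rightarrow> 'a set set" where
  "universally_measurable F =
     {A. A \<subseteq> space F \<and> (\<forall>\<mu>\<in>space (prob_algebra F). A \<in> sets (completion \<mu>))}"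

definition invariant_sets :: "'a measure \<Rightarrow> ('a \<times> 'a) set \<Rightarrow> 'a set set" where
  "invariant_sets F E =
     {A \<in> universally_measurable F. \<forall>(x, y)\<in>E. x \<in> A \<longleftrightarrow> y \<in> A}"

definition invariant_sets_on :: "'a measure \<Rightarrow> ('a \<times> 'a) set \<Rightarrow> 'a set \<Rightarrow> 'a set set" where
  "invariant_sets_on F E B =
     {A \<in> sets F. \<forall>(x, y)\<in>E \<inter> B \<times> B. x \<in> A \<longleftrightarrow> y \<in> A}"

text \<open>
  The unique extension of \<open>\<mu>\<close> to the universally measurable sets is the restriction of
  \<open>completion \<mu>\<close>, which agrees with \<open>\<mu>\<close> on \<open>sets \<mu>\<close>. The supremum is used only for nonempty
  families \<open>G\<close> of universally measurable sets; it is then over a nonempty subset of the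
  unit interval.
\<close>

definition sup_dist :: "'a set set \<Rightarrow> 'a measure \<Rightarrow> 'a measure \<Rightarrow> real" where
  "sup_dist G \<mu> \<nu> = (SUP A\<in>G. \<bar>measure (completion \<mu>) A - measure (completion \<nu>) A\<bar>)"

end

theory Submission
  imports Defs
begin

text \<open>
  Among finitely additive couplings, the Hahn-Banach theorem reduces \<open>min (1 - P E)\<close> to bounding
  \<open>\<mu> C + \<nu> D - 1\<close> over measurable \<open>C\<close>, \<open>D\<close> no point of which are \<open>E\<close>-related. The saturations of such
  \<open>C\<close> and \<open>D\<close> are disjoint analytic sets, so by Luzin's theorem an invariant Borel set \<open>A\<close> contains
  \<open>C\<close> and misses \<open>D\<close>, whence \<open>\<mu> C + \<nu> D - 1 \<le> \<mu> A - \<nu> A\<close>. As \<open>A\<close> is Borel and invariant on all of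
  \<open>\<Omega>\<close>, the same argument serves \<open>\<G>\<^sub>1\<close> and \<open>\<G>\<^sub>B\<close> with \<open>B = \<Omega>\<close>.
\<close>

section \<open>Separation of analytic sets\<close>

text \<open>Attainment rests on finite additivity. \<open>E\<close> need not be closed, so
  \<open>P E\<close> need not be upper semicontinuous under weak convergence of sigma-additive
  couplings; a Hahn-Banach functional asks for no such regularity. The target value \<open>s\<close>
  is fixed beforehand, and both demands on \<open>P\<close>, the marginals and
  \<open>1 - P E \<le> s\<close>, are written into one sublinear functional: the least price of
  bounding \<open>h\<close> by \<open>f x + g y - t * indicator E (x, y)\<close>. The rectangle
  estimate keeps that price finite once it is passed from indicators to bounded functions. That no
  coupling does better is weak duality. The obstacle there is that sets of
  \<open>\<G>\<^sub>1\<close> are only universally measurable, while \<open>P\<close> is controlled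
  only on the product of \<open>F\<close> with itself; such a set is replaced by a Borel subset for
  \<mu> and a Borel superset for \<nu>.\<close>

definition borel_separated :: "'a topology \<Rightarrow> 'a set \<Rightarrow> 'a set \<Rightarrow> bool" where
  "borel_separated X P Q \<longleftrightarrow>
     (\<exists>B\<in>sigma_sets (topspace X) {U. openin X U}. P \<subseteq> B \<and> B \<inter> Q = {})"

lemma sets_sigma_openin: "sets (sigma (topspace X) {U. openin X U}) = sigma_sets (topspace X) {U. openin X U}"
  by (rule sets_measure_of) (auto dest: openin_subset)

text \<open>Separating sets \<open>B i j\<close> for the pairs combine to
  \<open>\<Union>i\<in>I. \<Inter>j\<in>J. B i j\<close>. Read backwards, unseparated unions contain
  an unseparated pair of pieces. With \<open>J\<close> empty the inner intersection would be
  \<open>UNIV\<close>, which may leave \<open>topspace X\<close>.\<close>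

lemma borel_separated_UN:
  assumes "countable I" "countable J" "J \<noteq> {}"
    and sep: "\<And>i j. i \<in> I \<Longrightarrow> j \<in> J \<Longrightarrow> borel_separated X (P i) (Q j)"
  shows "borel_separated X (\<Union>i\<in>I. P i) (\<Union>j\<in>J. Q j)"
proof -
  let ?M = "sigma (topspace X) {U. openin X U}"
  have "\<forall>i\<in>I. \<forall>j\<in>J. \<exists>B. B \<in> sets ?M \<and> P i \<subseteq> B \<and> B \<inter> Q j = {}"
    using sep unfolding borel_separated_def sets_sigma_openin by meson
  then obtain B where B: "\<And>i j. i \<in> I \<Longrightarrow> j \<in> J \<Longrightarrow> B i j \<in> sets ?M \<and> P i \<subseteq> B i j \<and> B i j \<inter> Q j = {}"
    by metis
  have "(\<Union>i\<in>I. \<Inter>j\<in>J. B i j) \<in> sets ?M"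
    using B by (intro sets.countable_UN'[OF \<open>countable I\<close>] image_subsetI
        sets.countable_INT'[OF \<open>countable J\<close> \<open>J \<noteq> {}\<close>]) blast
  moreover have "(\<Union>i\<in>I. P i) \<subseteq> (\<Union>i\<in>I. \<Inter>j\<in>J. B i j)" "(\<Union>i\<in>I. \<Inter>j\<in>J. B i j) \<inter> (\<Union>j\<in>J. Q j) = {}"
    using B by blast+
  ultimately show ?thesis
    unfolding borel_separated_def sets_sigma_openin by blast
qed

text \<open>Closed balls keep the pieces of a closed set closed, as the nested-set form of
  completeness requires.\<close>

lemma (in Metric_space) mcball_cover:
  assumes "D \<subseteq> M" "mtopology closure_of D = M" "\<epsilon> > 0" "S \<subseteq> M"
  shows "S = (\<Union>a\<in>D. S \<inter> mcball a \<epsilon>)"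
proof -
  have "\<exists>a\<in>D. x \<in> mcball a \<epsilon>" if "x \<in> M" for x
  proof -
    have "x \<in> mtopology closure_of D" using that assms by simp
    then obtain a where "a \<in> D" "a \<in> mball x \<epsilon>"
      using \<open>\<epsilon> > 0\<close> unfolding metric_closure_of by blast
    then show ?thesis using assms(1) by (intro bexI[of _ a]) (auto simp: commute)
  qed
  then show ?thesis using assms(4) by blast
qed

text \<open>Luzin's argument: an unseparated pair splits into countably many pairs of small closed
  pieces, one of which is again unseparated. Iterating, the pieces shrink to points \<open>x\<close>
  and \<open>y\<close> with \<open>f x \<noteq> f y\<close>, and disjoint open neighbourhoods of
  these values separate the images of late pieces.\<close>

lemma (in Metric_space) closed_image_borel_separated:
  assumes mc: "mcomplete" and sp: "separable_space mtopology"
    and f: "continuous_map mtopology X f" and X: "Hausdorff_space X"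
    and K: "closedin mtopology K" and K': "closedin mtopology K'"
    and disj: "f ` K \<inter> f ` K' = {}"
  shows "borel_separated X (f ` K) (f ` K')"
proof (rule ccontr)
  assume nsep: "\<not> ?thesis"
  obtain D where D: "countable D" "D \<subseteq> M" "mtopology closure_of D = M"
    using sp by (auto simp: separable_space_def)
  define good where "good = (\<lambda>(P, Q). closedin mtopology P \<and> closedin mtopology Q \<and> P \<subseteq> K \<and> Q \<subseteq> K' \<and>
     \<not> borel_separated X (f ` P) (f ` Q))"
  have step: "\<exists>y. good y \<and> fst y \<subseteq> fst x \<and> snd y \<subseteq> snd x
        \<and> (\<exists>a. fst y \<subseteq> mcball a (1 / real (Suc n))) \<and> (\<exists>a. snd y \<subseteq> mcball a (1 / real (Suc n)))"
    if "good x" for x n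
  proof -
    obtain P Q where x: "x = (P, Q)" by force
    have PQ: "closedin mtopology P" "closedin mtopology Q" "\<not> borel_separated X (f ` P) (f ` Q)"
      "P \<subseteq> K" "Q \<subseteq> K'"
      using that by (auto simp: good_def x)
    let ?e = "1 / real (Suc n)"
    have PM: "P \<subseteq> M" "Q \<subseteq> M" using PQ closedin_subset by fastforce+
    have P: "P = (\<Union>a\<in>D. P \<inter> mcball a ?e)" and Q: "Q = (\<Union>a\<in>D. Q \<inter> mcball a ?e)"
      using mcball_cover[OF D(2,3) _ PM(1)] mcball_cover[OF D(2,3) _ PM(2)] by simp_all
    have "D \<noteq> {}"
    proof
      assume "D = {}"
      then have "P = {}" using P by auto
      then show False using PQ(3) by (auto simp: borel_separated_def intro: sigma_sets.Empty)
    qed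
    have "\<exists>a\<in>D. \<exists>b\<in>D. \<not> borel_separated X (f ` (P \<inter> mcball a ?e)) (f ` (Q \<inter> mcball b ?e))"
    proof (rule ccontr)
      assume "\<not> ?thesis"
      then have "borel_separated X (\<Union>a\<in>D. f ` (P \<inter> mcball a ?e)) (\<Union>b\<in>D. f ` (Q \<inter> mcball b ?e))"
        using D(1) \<open>D \<noteq> {}\<close> by (intro borel_separated_UN) auto
      then show False using PQ(3) P Q by (metis image_UN)
    qed
    then obtain a b where "\<not> borel_separated X (f ` (P \<inter> mcball a ?e)) (f ` (Q \<inter> mcball b ?e))"
      by blast
    then show ?thesis
      using PQ by (intro exI[of _ "(P \<inter> mcball a ?e, Q \<inter> mcball b ?e)"])
        (auto simp: good_def x intro: closedin_Int)
  qed
  obtain c where c: "\<And>n::nat. good (c n)" "\<And>n. fst (c (Suc n)) \<subseteq> fst (c n) \<and> snd (c (Suc n)) \<subseteq> snd (c n)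
        \<and> (\<exists>a. fst (c (Suc n)) \<subseteq> mcball a (1 / real (Suc n))) \<and> (\<exists>a. snd (c (Suc n)) \<subseteq> mcball a (1 / real (Suc n)))"
  proof -
    have "\<exists>c. \<forall>n::nat. good (c n) \<and> (fst (c (Suc n)) \<subseteq> fst (c n) \<and> snd (c (Suc n)) \<subseteq> snd (c n)
        \<and> (\<exists>a. fst (c (Suc n)) \<subseteq> mcball a (1 / real (Suc n))) \<and> (\<exists>a. snd (c (Suc n)) \<subseteq> mcball a (1 / real (Suc n))))"
      by (rule dependent_nat_choice) (use K K' nsep step in \<open>auto simp: good_def\<close>)
    then show ?thesis using that by blast
  qed
  \<comment> \<open>Completeness supplies a point common to all pieces; since their diameters
    vanish, continuity at that point puts the images of late pieces into any neighbourhood of its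
    value.\<close>
  have limit: "\<exists>x\<in>M. x \<in> C 0 \<and> (\<forall>V. openin X V \<longrightarrow> f x \<in> V \<longrightarrow> (\<forall>\<^sub>F n in sequentially. f ` C n \<subseteq> V))"
    if C: "\<And>n::nat. closedin mtopology (C n)" "\<And>n. C n \<noteq> {}" "\<And>n. C (Suc n) \<subseteq> C n"
      "\<And>n. \<exists>a. C (Suc n) \<subseteq> mcball a (1 / real (Suc n))" for C
  proof -
    have dec: "decseq C" using C(3) by (simp add: decseq_Suc_iff)
    have small: "\<exists>n. \<exists>a. C n \<subseteq> mcball a e" if e: "e > 0" for e
    proof -
      obtain n where n: "1 / real (Suc n) < e" using reals_Archimedean[OF e] by (auto simp: inverse_eq_divide)
      obtain a where "C (Suc n) \<subseteq> mcball a (1 / real (Suc n))" using C(4) by blast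
      also have "\<dots> \<subseteq> mcball a e" using n by (intro mcball_subset_concentric) auto
      finally show ?thesis by blast
    qed
    then have "\<Inter> (range C) \<noteq> {}"
      using mc C dec unfolding mcomplete_nest by blast
    then obtain x where x: "\<And>n. x \<in> C n" by blast
    then have xM: "x \<in> M" using C(1) closedin_subset by fastforce
    have "\<forall>\<^sub>F n in sequentially. f ` C n \<subseteq> V" if V: "openin X V" "f x \<in> V" for V
    proof -
      have "openin mtopology {y \<in> M. f y \<in> V}"
        using openin_continuous_map_preimage[OF f V(1)] by simp
      then obtain r where r: "r > 0" "mball x r \<subseteq> {y \<in> M. f y \<in> V}"
        using V(2) xM unfolding openin_mtopology by blast
      \<comment> \<open>Two points of \<open>mcball a (r/3)\<close> are at distance at most
        \<open>2 * r / 3\<close>, so the common point \<open>x\<close> can take over as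
        centre.\<close>
      obtain n a where na: "C n \<subseteq> mcball a (r/3)" using small[of "r/3"] r by auto
      have "C n \<subseteq> mball x r"
      proof
        fix y assume "y \<in> C n"
        then have "y \<in> mcball a (r/3)" "x \<in> mcball a (r/3)" using na x by blast+
        then show "y \<in> mball x r" using r triangle[of x a y] by (auto simp: commute)
      qed
      then have "\<forall>m\<ge>n. f ` C m \<subseteq> V" using dec r(2) by (fastforce simp: decseq_def)
      then show ?thesis by (auto simp: eventually_sequentially)
    qed
    then show ?thesis using x xM by blast
  qed
  \<comment> \<open>Nested completeness needs nonempty pieces. An empty left piece would be
    separated by \<open>{}\<close> and an empty right piece by \<open>topspace X\<close>, against
    the choice of \<open>c\<close>.\<close>
  have ne: "fst (c n) \<noteq> {}" "snd (c n) \<noteq> {}" for n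
  proof -
    have ns: "\<not> borel_separated X (f ` fst (c n)) (f ` snd (c n))" "closedin mtopology (fst (c n))"
      using c(1)[of n] by (auto simp: good_def split: prod.splits)
    have "f ` fst (c n) \<subseteq> topspace X"
      using ns(2) f by (metis closedin_subset continuous_map_image_subset_topspace image_mono subset_trans)
    then have "borel_separated X (f ` fst (c n)) {}"
      unfolding borel_separated_def using sigma_sets_top by blast
    then show "snd (c n) \<noteq> {}" using ns by auto
    have "borel_separated X {} (f ` snd (c n))"
      unfolding borel_separated_def using sigma_sets.Empty by blast
    then show "fst (c n) \<noteq> {}" using ns by auto
  qed
  have cl: "closedin mtopology (fst (c n))" "closedin mtopology (snd (c n))"
    "fst (c n) \<subseteq> K" "snd (c n) \<subseteq> K'" "\<not> borel_separated X (f ` fst (c n)) (f ` snd (c n))" for n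
    using c(1)[of n] by (auto simp: good_def split: prod.splits)
  obtain x where x: "x \<in> M" "x \<in> fst (c 0)" "\<And>V. openin X V \<Longrightarrow> f x \<in> V \<Longrightarrow> (\<forall>\<^sub>F n in sequentially. f ` fst (c n) \<subseteq> V)"
    using limit[of "\<lambda>n. fst (c n)"] cl ne c(2) by blast
  obtain y where y: "y \<in> M" "y \<in> snd (c 0)" "\<And>V. openin X V \<Longrightarrow> f y \<in> V \<Longrightarrow> (\<forall>\<^sub>F n in sequentially. f ` snd (c n) \<subseteq> V)"
    using limit[of "\<lambda>n. snd (c n)"] cl ne c(2) by blast
  have "f x \<noteq> f y" using x(2) y(2) cl(3,4)[of 0] disj by blast
  moreover have "f x \<in> topspace X" "f y \<in> topspace X"
    using f x(1) y(1) by (auto simp: continuous_map_def)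
  ultimately obtain U V where UV: "openin X U" "openin X V" "f x \<in> U" "f y \<in> V" "disjnt U V"
    using X unfolding Hausdorff_space_def by meson
  have "\<forall>\<^sub>F n in sequentially. f ` fst (c n) \<subseteq> U \<and> f ` snd (c n) \<subseteq> V"
    using x(3)[OF UV(1,3)] y(3)[OF UV(2,4)] by eventually_elim auto
  then obtain n where "f ` fst (c n) \<subseteq> U" "f ` snd (c n) \<subseteq> V"
    by (auto simp: eventually_sequentially)
  then have "borel_separated X (f ` fst (c n)) (f ` snd (c n))"
    unfolding borel_separated_def using UV by (intro bexI[of _ U]) (auto simp: disjnt_def)
  then show False using cl(5) by blast
qed

section \<open>Borel sets are analytic\<close>

text \<open>Over a Polish \<open>Z\<close> these are the classical analytic sets. The witness is
  closed in the product with Baire space, so the separation lemma for images of closed sets applies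
  to it directly.\<close>

definition analytic_in :: "'a topology \<Rightarrow> 'a set \<Rightarrow> bool" where
  "analytic_in Z S \<longleftrightarrow>
     (\<exists>K. closedin (prod_topology Z (euclidean :: (nat \<Rightarrow> nat) topology)) K \<and> S = fst ` K)"

lemma closedin_imp_analytic_in:
  assumes "closedin Z S"
  shows "analytic_in Z S"
  unfolding analytic_in_def using assms
  by (intro exI[of _ "S \<times> UNIV"]) (auto simp: closedin_prod_Times_iff)

text \<open>Used with \<open>Suc\<close> to drop the first entry of \<open>b\<close>, and with
  \<open>\<lambda>n. prod_encode (i, n)\<close> to extract the \<open>i\<close>-th of the sequences
  packed into \<open>b\<close>.\<close>

lemma continuous_map_reindex:
  fixes \<phi> :: "nat \<Rightarrow> nat"
  shows "continuous_map (prod_topology Z euclidean) (prod_topology Z euclidean)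
     (\<lambda>(x, b :: nat \<Rightarrow> nat). (x, \<lambda>n. b (\<phi> n)))"
proof -
  have "continuous_map euclidean euclidean (\<lambda>(b :: nat \<Rightarrow> nat) n. b (\<phi> n))"
    unfolding continuous_map_iff_continuous2
    by (intro continuous_on_coordinatewise_then_product continuous_on_product_coordinates)
  then have "continuous_map (prod_topology Z euclidean) euclidean ((\<lambda>(b :: nat \<Rightarrow> nat) n. b (\<phi> n)) \<circ> snd)"
    by (rule continuous_map_compose[OF continuous_map_snd])
  then show ?thesis
    by (simp add: continuous_map_pairwise o_def case_prod_beta continuous_map_fst)
qed

text \<open>Entry \<open>0\<close> of the Baire point names the index \<open>i\<close>; the
  remaining entries are a witness for \<open>S i\<close>.\<close>

lemma analytic_in_UN:
  assumes "\<And>i::nat. analytic_in Z (S i)"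
  shows "analytic_in Z (\<Union>i. S i)"
proof -
  let ?B = "euclidean :: (nat \<Rightarrow> nat) topology"
  let ?ZB = "prod_topology Z ?B"
  have "\<forall>i. \<exists>K. closedin ?ZB K \<and> S i = fst ` K"
    using assms unfolding analytic_in_def by blast
  then obtain K where K: "\<And>i. closedin ?ZB (K i)" "\<And>i. S i = fst ` K i"
    by (auto dest!: choice)
  define g where "g = (\<lambda>(x, b). (x :: 'a, \<lambda>n. (b :: nat \<Rightarrow> nat) (Suc n)))"
  have cont: "continuous_map ?ZB ?ZB g"
    unfolding g_def by (rule continuous_map_reindex)
  let ?K = "{z \<in> topspace ?ZB. g z \<in> K (snd z 0)}"
  \<comment> \<open>The index \<open>snd z 0\<close> varies with the point, so \<open>?K\<close> is
    not a single preimage. Fixing its value is an open condition, which turns the complement into a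
    union of open sets.\<close>
  have "topspace ?ZB - ?K = (\<Union>i. {z \<in> topspace ?ZB. g z \<in> topspace ?ZB - K i} \<inter> {z \<in> topspace ?ZB. snd z \<in> {b. b 0 = i}})"
    by (auto simp: g_def)
  moreover have "openin ?ZB \<dots>"
  proof (intro openin_Union openin_Int ballI; (elim imageE)?)
    fix U i
    have "continuous_on UNIV (\<lambda>b :: nat \<Rightarrow> nat. b 0)" by simp
    then have "open {b :: nat \<Rightarrow> nat. b 0 = i}"
      using open_vimage[of "{i}" "\<lambda>b :: nat \<Rightarrow> nat. b 0"] by (simp add: vimage_def discrete_topology_class.open_discrete)
    then have "openin ?ZB {z \<in> topspace ?ZB. snd z \<in> {b. b 0 = i}}"
      by (intro openin_continuous_map_preimage[OF continuous_map_snd]) auto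
    moreover have "openin ?ZB {z \<in> topspace ?ZB. g z \<in> topspace ?ZB - K i}"
      using K(1) by (intro openin_continuous_map_preimage[OF cont]) (auto simp: closedin_def)
    moreover assume "U = {z \<in> topspace ?ZB. g z \<in> topspace ?ZB - K i} \<inter> {z \<in> topspace ?ZB. snd z \<in> {b. b 0 = i}}"
    ultimately show "openin ?ZB U" by (simp only: openin_Int)
  qed
  ultimately have "closedin ?ZB ?K" by (auto simp: closedin_def)
  moreover have "(\<Union>i. S i) = fst ` ?K"
  proof (intro subset_antisym subsetI)
    fix x assume "x \<in> (\<Union>i. S i)"
    then obtain i b where xb: "(x, b) \<in> K i" using K(2) by auto
    then have "(x, b) \<in> topspace ?ZB" using closedin_subset[OF K(1)] by blast
    then have "(x, \<lambda>n. case n of 0 \<Rightarrow> i | Suc m \<Rightarrow> b m) \<in> ?K"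
      using xb by (auto simp: g_def)
    then show "x \<in> fst ` ?K" by (rule image_eqI[rotated]) simp
  next
    fix x assume "x \<in> fst ` ?K"
    then obtain b where "g (x, b) \<in> K (b 0)" by auto
    then have "x \<in> fst ` K (b 0)" by (intro image_eqI) (auto simp: g_def)
    then show "x \<in> (\<Union>i. S i)" using K(2) by blast
  qed
  ultimately show ?thesis unfolding analytic_in_def by blast
qed

text \<open>One Baire point carries witnesses for all \<open>S i\<close> at once, interleaved by
  \<open>prod_encode\<close>; each condition is a closed preimage, hence so is their conjunction
  closed.\<close>

lemma analytic_in_INT:
  assumes "\<And>i::nat. analytic_in Z (S i)"
  shows "analytic_in Z (\<Inter>i. S i)"
proof -
  let ?B = "euclidean :: (nat \<Rightarrow> nat) topology"
  let ?ZB = "prod_topology Z ?B"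
  have "\<forall>i. \<exists>K. closedin ?ZB K \<and> S i = fst ` K"
    using assms unfolding analytic_in_def by blast
  then obtain K where K: "\<And>i. closedin ?ZB (K i)" "\<And>i. S i = fst ` K i"
    by (auto dest!: choice)
  define g where "g i = (\<lambda>(x, b). (x :: 'a, \<lambda>n. (b :: nat \<Rightarrow> nat) (prod_encode (i, n))))" for i
  have cont: "continuous_map ?ZB ?ZB (g i)" for i
    unfolding g_def by (rule continuous_map_reindex)
  let ?K = "\<Inter>i. {z \<in> topspace ?ZB. g i z \<in> K i}"
  have "closedin ?ZB ?K"
    using cont K(1) by (intro closedin_INT closedin_continuous_map_preimage) auto
  moreover have "(\<Inter>i. S i) = fst ` ?K"
  proof (intro subset_antisym subsetI)
    fix x assume "x \<in> (\<Inter>i. S i)"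
    then have "\<forall>i. \<exists>b. (x, b) \<in> K i" using K(2) by fastforce
    then obtain b where b: "\<And>i. (x, b i) \<in> K i" by metis
    then have "(x, b i) \<in> topspace ?ZB" for i using closedin_subset[OF K(1)] by blast
    then have "(x, \<lambda>k. case prod_decode k of (i, n) \<Rightarrow> b i n) \<in> ?K"
      using b by (auto simp: g_def)
    then show "x \<in> fst ` ?K" by (rule image_eqI[rotated]) simp
  next
    fix x assume "x \<in> fst ` ?K"
    then obtain b where b: "\<forall>i. g i (x, b) \<in> K i" by auto
    have "x \<in> fst ` K i" for i using spec[OF b, of i] by (intro image_eqI) (auto simp: g_def)
    then show "x \<in> (\<Inter>i. S i)" using K(2) by blast
  qed
  ultimately show ?thesis unfolding analytic_in_def by blast
qed

lemma completely_metrizable_space_Baire: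
  "completely_metrizable_space (euclidean :: (nat \<Rightarrow> nat) topology)"
proof -
  have "(euclidean :: nat topology) = discrete_topology UNIV"
    unfolding topology_eq by (simp add: discrete_topology_class.open_discrete flip: open_openin)
  then have "completely_metrizable_space (euclidean :: nat topology)"
    by (simp only: completely_metrizable_space_discrete_topology)
  then show ?thesis
    by (simp add: completely_metrizable_space_product_topology flip: euclidean_product_topology)
qed

lemma separable_space_second_countable_type:
  "separable_space (euclidean :: 'a::second_countable_topology topology)"
proof -
  obtain D :: "'a set" where D: "countable D" "\<And>U. open U \<Longrightarrow> U \<noteq> {} \<Longrightarrow> \<exists>d\<in>D. d \<in> U"
    using countable_dense_exists by metis
  have "euclidean closure_of D = UNIV"
    using D(2) unfolding closure_of_def by (fastforce simp flip: open_openin)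
  then show ?thesis unfolding separable_space_def using D(1) by auto
qed

lemma separable_space_prod_topology:
  assumes "separable_space X" "separable_space Y"
  shows "separable_space (prod_topology X Y)"
proof -
  obtain C D where "countable C" "C \<subseteq> topspace X" "X closure_of C = topspace X"
      "countable D" "D \<subseteq> topspace Y" "Y closure_of D = topspace Y"
    using assms unfolding separable_space_def by blast
  then show ?thesis
    unfolding separable_space_def by (intro exI[of _ "C \<times> D"]) (auto simp: closure_of_Times)
qed

text \<open>Analytic sets are not closed under complements; bianalytic sets are.\<close>

lemma bianalytic_sigma_algebra:
  "sigma_algebra (topspace Z) {S. S \<subseteq> topspace Z \<and> analytic_in Z S \<and> analytic_in Z (topspace Z - S)}"
  unfolding sigma_algebra_iff2
proof (intro conjI ballI allI impI)
  fix A :: "nat \<Rightarrow> 'a set"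
  assume "range A \<subseteq> {S. S \<subseteq> topspace Z \<and> analytic_in Z S \<and> analytic_in Z (topspace Z - S)}"
  then have A: "A i \<subseteq> topspace Z" "analytic_in Z (A i)" "analytic_in Z (topspace Z - A i)" for i
    by auto
  have "topspace Z - (\<Union>i. A i) = (\<Inter>i. topspace Z - A i)" by blast
  then show "(\<Union>i. A i) \<in> {S. S \<subseteq> topspace Z \<and> analytic_in Z S \<and> analytic_in Z (topspace Z - S)}"
    using A analytic_in_UN[of Z A] analytic_in_INT[of Z "\<lambda>i. topspace Z - A i"] by auto
qed (auto simp: double_diff intro!: closedin_imp_analytic_in)

text \<open>The bianalytic sets form a sigma-field that contains the open sets, because these are
  F-sigma in a metrizable space. Both projections are therefore measurable from it to
  \<open>F\<close>, which puts all of \<open>F \<Otimes>\<^sub>M F\<close> into it without comparing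
  the product sigma-field with the Borel sets of the product topology.\<close>

lemma measurable_pair_imp_analytic_in:
  assumes T: "metrizable_space T" and F: "space F = topspace T" "sets F = sigma_sets (topspace T) {U. openin T U}"
    and H: "H \<in> sets (F \<Otimes>\<^sub>M F)"
  shows "analytic_in (prod_topology T T) H"
proof -
  let ?Z = "prod_topology T T"
  let ?D = "{S. S \<subseteq> topspace ?Z \<and> analytic_in ?Z S \<and> analytic_in ?Z (topspace ?Z - S)}"
  let ?M = "sigma (topspace ?Z) ?D"
  interpret sigma_algebra "topspace ?Z" ?D by (rule bianalytic_sigma_algebra)
  have sets: "sets ?M = ?D" by (rule sets_measure_of_eq)
  have space: "space ?M = topspace ?Z" by (rule space_measure_of_eq)
  have Z: "metrizable_space ?Z" using T by (simp add: metrizable_space_prod_topology)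
  have open_D: "S \<in> ?D" if S: "openin ?Z S" for S
  proof -
    obtain C where "\<And>n::nat. closedin ?Z (C n)" "(\<Union>n. C n) = S"
      using open_imp_fsigma_in[OF Z S] unfolding fsigma_in_ascending by blast
    then have "analytic_in ?Z S" using analytic_in_UN closedin_imp_analytic_in by metis
    moreover have "S \<subseteq> topspace ?Z" "closedin ?Z (topspace ?Z - S)"
      using S openin_subset by blast+
    ultimately show ?thesis using closedin_imp_analytic_in by blast
  qed
  have meas: "f \<in> measurable ?M F" if f: "continuous_map ?Z T f" for f
  proof (rule measurable_sigma_sets[OF F(2)])
    show "f \<in> space ?M \<rightarrow> topspace T" using f unfolding space continuous_map_def by blast
    fix U assume "U \<in> {U. openin T U}"
    then have "openin ?Z {z \<in> topspace ?Z. f z \<in> U}"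
      using openin_continuous_map_preimage[OF f] by simp
    moreover have "f -` U \<inter> space ?M = {z \<in> topspace ?Z. f z \<in> U}" unfolding space by blast
    ultimately show "f -` U \<inter> space ?M \<in> sets ?M" unfolding sets using open_D by simp
  qed (auto dest: openin_subset)
  \<comment> \<open>This is the identity; its measurability is the inclusion of
    \<open>F \<Otimes>\<^sub>M F\<close> in the bianalytic sets.\<close>
  have "(\<lambda>z. (fst z, snd z)) \<in> measurable ?M (F \<Otimes>\<^sub>M F)"
    by (intro measurable_Pair meas continuous_map_fst continuous_map_snd)
  from measurable_sets[OF this H] have "H \<inter> space ?M \<in> ?D" unfolding sets by simp
  moreover have "H \<inter> space ?M = H"
    using sets.sets_into_space[OF H] unfolding space by (auto simp: space_pair_measure F)
  ultimately show ?thesis by simp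
qed

section \<open>Separation by invariant Borel sets\<close>

text \<open>Saturations are second projections of measurable sets of pairs. They are continuous
  images of closed subsets of a Polish space: first project along Baire space, then to the second
  coordinate.\<close>

lemma standard_borel_separation:
  assumes F: "standard_borel F" and H: "H \<in> sets (F \<Otimes>\<^sub>M F)" "H' \<in> sets (F \<Otimes>\<^sub>M F)"
    and disj: "snd ` H \<inter> snd ` H' = {}"
  obtains B where "B \<in> sets F" "snd ` H \<subseteq> B" "B \<inter> snd ` H' = {}"
proof -
  obtain T where T: "completely_metrizable_space T" "separable_space T"
    "space F = topspace T" "sets F = sigma_sets (topspace T) {U. openin T U}"
    using F unfolding standard_borel_def by blast
  have mT: "metrizable_space T" using T(1) by (rule completely_metrizable_imp_metrizable_space)
  let ?Y = "prod_topology (prod_topology T T) (euclidean :: (nat \<Rightarrow> nat) topology)"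
  have Y: "completely_metrizable_space ?Y" "separable_space ?Y"
    using T(1,2) by (simp_all add: completely_metrizable_space_prod_topology completely_metrizable_space_Baire
        separable_space_prod_topology separable_space_second_countable_type)
  obtain M d where Md: "Metric_space M d" "Metric_space.mcomplete M d" "?Y = Metric_space.mtopology M d"
    using Y(1) unfolding completely_metrizable_space_def by blast
  obtain K K' where K: "closedin ?Y K" "H = fst ` K" "closedin ?Y K'" "H' = fst ` K'"
    using measurable_pair_imp_analytic_in[OF mT T(3,4) H(1)] measurable_pair_imp_analytic_in[OF mT T(3,4) H(2)]
    unfolding analytic_in_def by blast
  have "continuous_map ?Y T (snd \<circ> fst)"
    by (rule continuous_map_compose[OF continuous_map_fst continuous_map_snd])
  then have "borel_separated T ((snd \<circ> fst) ` K) ((snd \<circ> fst) ` K')"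
    using disj unfolding K(2,4) image_comp
    by (intro Metric_space.closed_image_borel_separated[OF Md(1,2), folded Md(3), OF Y(2)]
        metrizable_imp_Hausdorff_space[OF mT] K(1,3))
  then obtain B where "B \<in> sets F" "snd ` H \<subseteq> B" "B \<inter> snd ` H' = {}"
    unfolding borel_separated_def K(2,4) image_comp T(4) by (elim bexE conjE)
  then show ?thesis by (rule that)
qed

text \<open>Separating the saturations of \<open>C\<close> and \<open>D\<close> by a Borel set need not give an invariant set;
  alternating between saturations and separating sets does so in the limit.\<close>

lemma invariant_separation:
  assumes F: "standard_borel F" and E: "measurable_equivalence F E" and CD: "C \<in> sets F" "D \<in> sets F"
    and disj: "E \<inter> C \<times> D = {}"
  obtains A where "A \<in> invariant_sets_on F E (space F)" "C \<subseteq> A" "A \<inter> D = {}"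
proof -
  have ES: "E \<in> sets (F \<Otimes>\<^sub>M F)" and eq: "equiv (space F) E"
    using E by (auto simp: measurable_equivalence_def)
  have E_sub: "E \<subseteq> space F \<times> space F"
    using sets.sets_into_space[OF ES] by (simp add: space_pair_measure)
  have sym: "sym E" and trans: "trans E" and refl: "refl_on (space F) E"
    using eq by (auto elim: equivE)
  have img: "snd ` (E \<inter> S \<times> space F) = E `` S" for S using E_sub by force
  \<comment> \<open>The property kept is disjointness from the saturation of \<open>D\<close>, not
    just from \<open>D\<close>. As classes are equal or disjoint, it passes from \<open>B\<close> to
    the saturation of \<open>B\<close>, so the two saturations can be separated again.\<close>
  have step: "\<exists>B'. (B' \<in> sets F \<and> B' \<inter> E `` D = {}) \<and> E `` B \<subseteq> B'"
    if B: "B \<in> sets F \<and> B \<inter> E `` D = {}" for B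
  proof -
    have "snd ` (E \<inter> B \<times> space F) \<inter> snd ` (E \<inter> D \<times> space F) = {}"
    proof -
      have False if "(b, z) \<in> E" "(a, z) \<in> E" "b \<in> B" "a \<in> D" for a b z
        using B symD[OF sym that(1)] transD[OF trans that(2)] that(3,4) by blast
      then show ?thesis unfolding img by blast
    qed
    moreover have "E \<inter> B \<times> space F \<in> sets (F \<Otimes>\<^sub>M F)" "E \<inter> D \<times> space F \<in> sets (F \<Otimes>\<^sub>M F)"
      using ES B CD by auto
    ultimately obtain B' where "B' \<in> sets F" "E `` B \<subseteq> B'" "B' \<inter> E `` D = {}"
      using standard_borel_separation[OF F, of "E \<inter> B \<times> space F" "E \<inter> D \<times> space F"] unfolding img by metis
    then show ?thesis by blast
  qed
  have C0: "C \<inter> E `` D = {}" using disj symD[OF sym] by blast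
  have "\<exists>B. \<forall>n. (B n \<in> sets F \<and> B n \<inter> E `` D = {} \<and> (n = 0 \<longrightarrow> B n = C)) \<and> E `` B n \<subseteq> B (Suc n)"
  proof (rule dependent_nat_choice)
    show "\<exists>x. x \<in> sets F \<and> x \<inter> E `` D = {} \<and> ((0::nat) = 0 \<longrightarrow> x = C)" using CD(1) C0 by simp
    fix x :: "'a set" and n :: nat
    assume "x \<in> sets F \<and> x \<inter> E `` D = {} \<and> (n = 0 \<longrightarrow> x = C)"
    then have "\<exists>B'. (B' \<in> sets F \<and> B' \<inter> E `` D = {}) \<and> E `` x \<subseteq> B'" by (intro step) (elim conjE, intro conjI)
    then show "\<exists>y. (y \<in> sets F \<and> y \<inter> E `` D = {} \<and> (Suc n = 0 \<longrightarrow> y = C)) \<and> E `` x \<subseteq> y" by simp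
  qed
  then obtain B :: "nat \<Rightarrow> 'a set" where
    "\<forall>n. (B n \<in> sets F \<and> B n \<inter> E `` D = {} \<and> (n = 0 \<longrightarrow> B n = C)) \<and> E `` B n \<subseteq> B (Suc n)" ..
  then have B: "B n \<in> sets F \<and> B n \<inter> E `` D = {} \<and> (n = 0 \<longrightarrow> B n = C)" "E `` B n \<subseteq> B (Suc n)" for n
    by simp_all
  let ?A = "\<Union>n. B n"
  have fwd: "y \<in> ?A" if xy: "(x, y) \<in> E" "x \<in> ?A" for x y
  proof -
    obtain n where "x \<in> B n" using xy(2) by blast
    then have "y \<in> B (Suc n)" using B(2)[of n] xy(1) by blast
    then show ?thesis by blast
  qed
  have "x \<in> ?A \<longleftrightarrow> y \<in> ?A" if "(x, y) \<in> E" for x y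
    using fwd[OF that] fwd[OF symD[OF sym that]] by blast
  moreover have "?A \<in> sets F" using B(1) by (intro sets.countable_UN) auto
  ultimately have "?A \<in> invariant_sets_on F E (space F)"
    unfolding invariant_sets_on_def by blast
  moreover have "D \<subseteq> E `` D"
    using refl_onD[OF refl] sets.sets_into_space[OF CD(2)] by blast
  then have "?A \<inter> D = {}" using B(1) by blast
  moreover have "C \<subseteq> ?A" using B(1)[of 0] by blast
  ultimately show ?thesis by (intro that)
qed

section \<open>The Hahn-Banach theorem for function spaces\<close>

text \<open>Homogeneity is stated as an inequality, which is easier to verify for infima; using it
  for \<open>c\<close> and \<open>1/c\<close> gives equality.\<close>

definition sublinear_on :: "('x \<Rightarrow> real) set \<Rightarrow> (('x \<Rightarrow> real) \<Rightarrow> real) \<Rightarrow> bool" where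
  "sublinear_on V p \<longleftrightarrow>
     (\<forall>f\<in>V. \<forall>g\<in>V. p (\<lambda>x. f x + g x) \<le> p f + p g) \<and>
     (\<forall>f\<in>V. \<forall>c>0. p (\<lambda>x. c * f x) \<le> c * p f)"

lemma sublinear_onD:
  assumes "sublinear_on V p"
  shows "\<And>f g. f \<in> V \<Longrightarrow> g \<in> V \<Longrightarrow> p (\<lambda>x. f x + g x) \<le> p f + p g"
    and "\<And>f c. f \<in> V \<Longrightarrow> c > 0 \<Longrightarrow> p (\<lambda>x. c * f x) \<le> c * p f"
  using assms unfolding sublinear_on_def by simp_all

locale function_space =
  fixes V :: "('x \<Rightarrow> real) set"
  assumes zero: "(\<lambda>x. 0) \<in> V"
    and add: "f \<in> V \<Longrightarrow> g \<in> V \<Longrightarrow> (\<lambda>x. f x + g x) \<in> V"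
    and scale: "f \<in> V \<Longrightarrow> (\<lambda>x. c * f x) \<in> V"
begin

lemma uminus: "f \<in> V \<Longrightarrow> (\<lambda>x. - f x) \<in> V"
  using scale[of f "-1"] by simp

lemma sublinear_zero:
  assumes "sublinear_on V p"
  shows "p (\<lambda>x. 0) = 0"
proof -
  have "p (\<lambda>x. 0) \<le> p (\<lambda>x. 0) + p (\<lambda>x. 0)" "p (\<lambda>x. 0) \<le> (1/2) * p (\<lambda>x. 0)"
    using sublinear_onD(1)[OF assms zero zero] sublinear_onD(2)[OF assms zero, of "1/2"] by simp_all
  then show ?thesis by simp
qed

text \<open>Keeps pointwise infima finite: all sublinear functionals below \<open>p\<close> are at
  least \<open>- p (\<lambda>x. - f x)\<close> at \<open>f\<close>.\<close>

lemma sublinear_ge_uminus: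
  assumes "sublinear_on V p" "f \<in> V"
  shows "- p (\<lambda>x. - f x) \<le> p f"
proof -
  have "p (\<lambda>x. f x + - f x) \<le> p f + p (\<lambda>x. - f x)"
    by (rule sublinear_onD(1)[OF assms uminus[OF assms(2)]])
  then show ?thesis using sublinear_zero[OF assms(1)] by simp
qed

lemma sublinear_scale:
  assumes "sublinear_on V p" "f \<in> V" "c > 0"
  shows "p (\<lambda>x. c * f x) = c * p f"
proof -
  have "p (\<lambda>x. c * f x) \<le> c * p f" by (rule sublinear_onD(2)[OF assms])
  moreover have "p (\<lambda>x. (1/c) * (c * f x)) \<le> (1/c) * p (\<lambda>x. c * f x)"
    using sublinear_onD(2)[OF assms(1) scale[OF assms(2), of c], of "1/c"] assms(3) by simp
  then have "c * p f \<le> p (\<lambda>x. c * f x)" using assms(3) by (simp add: field_simps)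
  ultimately show ?thesis by simp
qed

text \<open>The functional \<open>h \<mapsto> INF t>0. m (h + t v) - t m v\<close> is sublinear and at most \<open>m\<close>, so it equals \<open>m\<close>;
  \<open>t = 1\<close> then gives superadditivity.\<close>

lemma minimal_sublinear_additive:
  assumes m: "sublinear_on V m"
    and min: "\<And>q. sublinear_on V q \<Longrightarrow> (\<And>f. f \<in> V \<Longrightarrow> q f \<le> m f) \<Longrightarrow> (\<And>f. f \<in> V \<Longrightarrow> q f = m f)"
    and f: "f \<in> V" and v: "v \<in> V"
  shows "m (\<lambda>x. f x + v x) = m f + m v"
proof -
  define Q where "Q h = (\<lambda>t. m (\<lambda>x. h x + t * v x) - t * m v) ` {0<..}" for h
  define q where "q h = Inf (Q h)" for h
  \<comment> \<open>Writing t v as (h + t v) - h bounds \<open>t * m v\<close>, so all values lie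
    above a number free of \<open>t\<close> and the infimum is real.\<close>
  have Q_ge: "- m (\<lambda>x. - h x) \<le> r" if h: "h \<in> V" and r: "r \<in> Q h" for h r
  proof -
    obtain t where t: "t > 0" "r = m (\<lambda>x. h x + t * v x) - t * m v" using r by (auto simp: Q_def)
    have "m (\<lambda>x. (h x + t * v x) + - h x) \<le> m (\<lambda>x. h x + t * v x) + m (\<lambda>x. - h x)"
      by (rule sublinear_onD(1)[OF m add[OF h scale[OF v]] uminus[OF h]])
    then show ?thesis using sublinear_scale[OF m v t(1)] t(2) by simp
  qed
  have bdd: "bdd_below (Q h)" if "h \<in> V" for h using Q_ge[OF that] by (rule bdd_belowI)
  have ne: "Q h \<noteq> {}" for h by (auto simp: Q_def)
  have q_le: "q h \<le> m (\<lambda>x. h x + t * v x) - t * m v" if "h \<in> V" "t > 0" for h t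
    unfolding q_def by (rule cInf_lower[OF _ bdd]) (use that in \<open>auto simp: Q_def\<close>)
  have q_m: "q h \<le> m h" if h: "h \<in> V" for h
  proof -
    have "m (\<lambda>x. h x + v x) \<le> m h + m v" by (rule sublinear_onD(1)[OF m h v])
    then show ?thesis using q_le[OF h, of 1] by simp
  qed
  have "sublinear_on V q"
    unfolding sublinear_on_def
  proof (intro conjI ballI allI impI)
    fix h k assume hk: "h \<in> V" "k \<in> V"
    \<comment> \<open>Parameters \<open>t\<close> for \<open>h\<close> and \<open>u\<close> for
      \<open>k\<close> are answered by \<open>t + u\<close> for the sum.\<close>
    have "q (\<lambda>x. h x + k x) \<le> r + s" if rs: "r \<in> Q h" "s \<in> Q k" for r s
    proof -
      obtain t u where t: "t > 0" "r = m (\<lambda>x. h x + t * v x) - t * m v"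
        and u: "u > 0" "s = m (\<lambda>x. k x + u * v x) - u * m v" using rs by (auto simp: Q_def)
      have "q (\<lambda>x. h x + k x) \<le> m (\<lambda>x. h x + k x + (t + u) * v x) - (t + u) * m v"
        using q_le[OF add[OF hk], of "t + u"] t u by simp
      also have "(\<lambda>x. h x + k x + (t + u) * v x) = (\<lambda>x. (h x + t * v x) + (k x + u * v x))"
        by (auto simp: algebra_simps)
      also have "m \<dots> \<le> m (\<lambda>x. h x + t * v x) + m (\<lambda>x. k x + u * v x)"
        by (rule sublinear_onD(1)[OF m add[OF hk(1) scale[OF v]] add[OF hk(2) scale[OF v]]])
      finally show ?thesis using t u by (simp add: algebra_simps)
    qed
    then have "q (\<lambda>x. h x + k x) - s \<le> q h" if "s \<in> Q k" for s
      unfolding q_def[of h] using that by (intro cInf_greatest ne) (simp add: algebra_simps)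
    then have "q (\<lambda>x. h x + k x) - q h \<le> q k"
      unfolding q_def[of k] by (intro cInf_greatest ne) (simp add: algebra_simps)
    then show "q (\<lambda>x. h x + k x) \<le> q h + q k" by simp
  next
    fix h and c :: real assume h: "h \<in> V" and c: "c > 0"
    have "q (\<lambda>x. c * h x) / c \<le> r" if r: "r \<in> Q h" for r
    proof -
      obtain t where t: "t > 0" "r = m (\<lambda>x. h x + t * v x) - t * m v" using r by (auto simp: Q_def)
      have "q (\<lambda>x. c * h x) \<le> m (\<lambda>x. c * h x + (c * t) * v x) - (c * t) * m v"
        using q_le[OF scale[OF h], of "c * t" c] c t by simp
      also have "(\<lambda>x. c * h x + (c * t) * v x) = (\<lambda>x. c * (h x + t * v x))"
        by (auto simp: algebra_simps)
      also have "m \<dots> = c * m (\<lambda>x. h x + t * v x)"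
        using c by (intro sublinear_scale[OF m] add[OF h scale[OF v]])
      finally have "q (\<lambda>x. c * h x) \<le> c * r" unfolding t(2) by (simp add: right_diff_distrib mult.assoc)
      then show ?thesis using c by (simp add: pos_divide_le_eq mult.commute)
    qed
    then have "q (\<lambda>x. c * h x) / c \<le> q h" unfolding q_def[of h] by (intro cInf_greatest ne)
    then show "q (\<lambda>x. c * h x) \<le> c * q h" using c by (simp add: field_simps)
  qed
  then have "q f = m f" using min[of q, OF _ q_m f] by blast
  then have "m f \<le> m (\<lambda>x. f x + v x) - m v" using q_le[OF f, of 1] by simp
  moreover have "m (\<lambda>x. f x + v x) \<le> m f + m v" by (rule sublinear_onD(1)[OF m f v])
  ultimately show ?thesis by simp
qed

text \<open>Zorn's lemma for the reversed pointwise order. A nonempty chain is bounded by its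
  infimum, which is subadditive because of any two members the smaller one serves both
  summands.\<close>

lemma exists_minimal_sublinear:
  assumes p: "sublinear_on V p"
  obtains m where "sublinear_on V m" "\<And>f. f \<in> V \<Longrightarrow> m f \<le> p f"
    "\<And>q f. sublinear_on V q \<Longrightarrow> (\<And>f. f \<in> V \<Longrightarrow> q f \<le> m f) \<Longrightarrow> f \<in> V \<Longrightarrow> q f = m f"
proof -
  \<comment> \<open>The order compares functionals on \<open>V\<close> only; fixing the value
    \<open>0\<close> elsewhere makes it antisymmetric.\<close>
  define restr where "restr q h = (if h \<in> V then q h else 0)" for q :: "('x \<Rightarrow> real) \<Rightarrow> real" and h
  have restr_sub: "sublinear_on V (restr q) \<longleftrightarrow> sublinear_on V q" for q
    using add scale by (simp add: sublinear_on_def restr_def)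
  define \<A> where "\<A> = {q. sublinear_on V q \<and> (\<forall>f\<in>V. q f \<le> p f) \<and> (\<forall>f. f \<notin> V \<longrightarrow> q f = 0)}"
  define below where "below q r \<longleftrightarrow> (\<forall>f\<in>V. r f \<le> q f)" for q r :: "('x \<Rightarrow> real) \<Rightarrow> real"
  have "\<exists>m\<in>\<A>. \<forall>q\<in>\<A>. below m q \<longrightarrow> q = m"
  proof (rule predicate_Zorn[of \<A> below])
    show "partial_order_on \<A> (relation_of below \<A>)"
    proof (rule partial_order_on_relation_ofI)
      fix a b assume ab: "a \<in> \<A>" "b \<in> \<A>" "below a b" "below b a"
      show "a = b"
      proof
        fix f show "a f = b f"
          using ab by (cases "f \<in> V") (auto simp: \<A>_def below_def intro: antisym)
      qed
    next
      fix a b c assume "below a b" "below b c"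
      then show "below a c" unfolding below_def by (meson order_trans)
    qed (simp add: below_def)
  next
    fix C assume C: "C \<in> Chains (relation_of below \<A>)"
    have CA: "q \<in> \<A>" if "q \<in> C" for q
      using C that unfolding Chains_def relation_of_def by blast
    have total: "below q r \<or> below r q" if "q \<in> C" "r \<in> C" for q r
      using C that unfolding Chains_def relation_of_def by blast
    show "\<exists>u\<in>\<A>. \<forall>a\<in>C. below a u"
    proof (cases "C = {}")
      case True
      have "restr p \<in> \<A>" using p restr_sub by (auto simp: \<A>_def restr_def)
      then show ?thesis using True by blast
    next
      case False
      define u where "u h = (INF q\<in>C. q h)" for h
      have bdd: "bdd_below ((\<lambda>q. q h) ` C)" if h: "h \<in> V" for h
      proof (rule bdd_belowI2)
        fix q assume "q \<in> C"
        then have q: "sublinear_on V q" "q (\<lambda>x. - h x) \<le> p (\<lambda>x. - h x)"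
          using CA uminus[OF h] by (auto simp: \<A>_def)
        then show "- p (\<lambda>x. - h x) \<le> q h" using sublinear_ge_uminus[OF q(1) h] by simp
      qed
      have u_le: "u h \<le> q h" if "h \<in> V" "q \<in> C" for h q
        unfolding u_def using that by (intro cINF_lower bdd)
      have "sublinear_on V u"
        unfolding sublinear_on_def
      proof (intro conjI ballI allI impI)
        fix h k assume hk: "h \<in> V" "k \<in> V"
        have "u (\<lambda>x. h x + k x) \<le> q h + r k" if qr: "q \<in> C" "r \<in> C" for q r
        proof -
          have *: "u (\<lambda>x. h x + k x) \<le> s h + s k" if "s \<in> C" for s
          proof -
            have "u (\<lambda>x. h x + k x) \<le> s (\<lambda>x. h x + k x)" by (intro u_le add hk that)
            also have "\<dots> \<le> s h + s k" using CA[OF that] unfolding \<A>_def by (intro sublinear_onD(1)[OF _ hk]) simp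
            finally show ?thesis .
          qed
          show ?thesis using total[OF qr] *[OF qr(1)] *[OF qr(2)] hk by (force simp: below_def)
        qed
        then have "u (\<lambda>x. h x + k x) - r k \<le> u h" if "r \<in> C" for r
          unfolding u_def[of h] using that by (intro cINF_greatest False) (simp add: algebra_simps)
        then have "u (\<lambda>x. h x + k x) - u h \<le> u k"
          unfolding u_def[of k] by (intro cINF_greatest False) (simp add: algebra_simps)
        then show "u (\<lambda>x. h x + k x) \<le> u h + u k" by simp
      next
        fix h and c :: real assume h: "h \<in> V" and c: "c > 0"
        have "u (\<lambda>x. c * h x) / c \<le> q h" if "q \<in> C" for q
        proof -
          have "u (\<lambda>x. c * h x) \<le> q (\<lambda>x. c * h x)" by (intro u_le scale h that)
          also have "\<dots> \<le> c * q h" using CA[OF that] unfolding \<A>_def by (intro sublinear_onD(2)[OF _ h c]) simp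
          finally show ?thesis using c by (simp add: field_simps)
        qed
        then have "u (\<lambda>x. c * h x) / c \<le> u h" unfolding u_def[of h] by (intro cINF_greatest False)
        then show "u (\<lambda>x. c * h x) \<le> c * u h" using c by (simp add: field_simps)
      qed
      moreover have "u h \<le> p h" if "h \<in> V" for h
      proof -
        obtain q where "q \<in> C" using False by blast
        then show ?thesis using u_le[OF that] CA[of q] that unfolding \<A>_def by force
      qed
      ultimately have "restr u \<in> \<A>" using restr_sub by (auto simp: \<A>_def restr_def)
      moreover have "\<forall>q\<in>C. below q (restr u)" using u_le by (auto simp: below_def restr_def)
      ultimately show ?thesis by blast
    qed
  qed
  then obtain m where m: "m \<in> \<A>" "\<And>q. q \<in> \<A> \<Longrightarrow> below m q \<Longrightarrow> q = m" by blast
  show thesis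
  proof
    show "sublinear_on V m" "\<And>f. f \<in> V \<Longrightarrow> m f \<le> p f" using m(1) by (auto simp: \<A>_def)
    fix q f assume q: "sublinear_on V q" "\<And>f. f \<in> V \<Longrightarrow> q f \<le> m f" and f: "f \<in> V"
    have "restr q \<in> \<A>" using q(1) restr_sub m(1) order_trans[OF q(2)] by (simp add: \<A>_def restr_def)
    moreover have "below m (restr q)" using q by (auto simp: below_def restr_def)
    ultimately have "restr q = m" by (rule m(2))
    then show "q f = m f" using f by (metis restr_def)
  qed
qed

text \<open>Minimality below \<open>p\<close> yields additivity, and with it oddness. Nothing is
  extended from a subspace: values to be prescribed must be forced by \<open>p\<close> at
  \<open>f\<close> and at its negative, as the marginals are later.\<close>

proposition Hahn_Banach:
  assumes "sublinear_on V p"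
  obtains L where "\<And>f g. f \<in> V \<Longrightarrow> g \<in> V \<Longrightarrow> L (\<lambda>x. f x + g x) = L f + L g"
    and "\<And>f. f \<in> V \<Longrightarrow> L f \<le> p f"
    and "\<And>f. f \<in> V \<Longrightarrow> L (\<lambda>x. - f x) = - L f"
proof -
  obtain m where m: "sublinear_on V m" "\<And>f. f \<in> V \<Longrightarrow> m f \<le> p f"
    "\<And>q f. sublinear_on V q \<Longrightarrow> (\<And>f. f \<in> V \<Longrightarrow> q f \<le> m f) \<Longrightarrow> f \<in> V \<Longrightarrow> q f = m f"
    using exists_minimal_sublinear[OF assms] by blast
  have add': "m (\<lambda>x. f x + g x) = m f + m g" if "f \<in> V" "g \<in> V" for f g
    by (rule minimal_sublinear_additive[OF m(1) _ that]) (rule m(3))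
  have "m (\<lambda>x. - f x) = - m f" if "f \<in> V" for f
    using add'[OF that uminus[OF that]] sublinear_zero[OF m(1)] by simp
  with add' m(2) that show ?thesis by blast
qed

end

section \<open>Finitely additive couplings\<close>

text \<open>The counts are at most the floor and the ceiling of \<open>r\<close>. The additive
  \<open>1\<close> in the strict case is the source of the error \<open>1 / real n\<close> in the
  averaging over levels.\<close>

lemma card_levels_le:
  fixes r :: real
  assumes "r \<ge> 0"
  shows "real (card ({..<n} \<inter> {j. real j + 1 \<le> r})) \<le> r"
    and "real (card ({..<n} \<inter> {j. real j < r})) \<le> r + 1"
proof -
  have "card ({..<n} \<inter> {j. real j + 1 \<le> r}) \<le> card {..<nat \<lfloor>r\<rfloor>}"
    by (intro card_mono) (auto, linarith)
  also have "real (card {..<nat \<lfloor>r\<rfloor>}) \<le> r" using assms by simp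
  finally show "real (card ({..<n} \<inter> {j. real j + 1 \<le> r})) \<le> r" by simp
  have "card ({..<n} \<inter> {j. real j < r}) \<le> card {..<nat \<lceil>r\<rceil>}"
    by (intro card_mono) (auto, linarith)
  also have "real (card {..<nat \<lceil>r\<rceil>}) \<le> r + 1" using assms by simp
  finally show "real (card ({..<n} \<inter> {j. real j < r})) \<le> r + 1" by simp
qed

definition bounded_measurable :: "'a measure \<Rightarrow> ('a \<Rightarrow> real) set" where
  "bounded_measurable F = {f \<in> borel_measurable F. \<exists>c. \<forall>x\<in>space F. \<bar>f x\<bar> \<le> c}"

lemma bounded_measurable_const: "(\<lambda>x. c) \<in> bounded_measurable F"
  by (auto simp: bounded_measurable_def)

lemma bounded_measurable_indicator: "A \<in> sets F \<Longrightarrow> indicator A \<in> bounded_measurable F"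
  by (auto simp: bounded_measurable_def indicator_def intro!: exI[of _ 1])

lemma bounded_measurable_add:
  assumes "f \<in> bounded_measurable F" "g \<in> bounded_measurable F"
  shows "(\<lambda>x. f x + g x) \<in> bounded_measurable F"
proof -
  obtain c d where "\<forall>x\<in>space F. \<bar>f x\<bar> \<le> c" "\<forall>x\<in>space F. \<bar>g x\<bar> \<le> d"
    using assms by (auto simp: bounded_measurable_def)
  then have "\<forall>x\<in>space F. \<bar>f x + g x\<bar> \<le> c + d" by (fastforce intro: abs_triangle_ineq[THEN order_trans])
  then show ?thesis using assms by (auto simp: bounded_measurable_def)
qed

lemma bounded_measurable_scale:
  assumes "f \<in> bounded_measurable F"
  shows "(\<lambda>x. c * f x) \<in> bounded_measurable F"
proof -
  obtain d where "\<forall>x\<in>space F. \<bar>f x\<bar> \<le> d" using assms by (auto simp: bounded_measurable_def)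
  then have "\<forall>x\<in>space F. \<bar>c * f x\<bar> \<le> \<bar>c\<bar> * d" by (simp add: abs_mult mult_left_mono)
  then show ?thesis using assms by (auto simp: bounded_measurable_def)
qed

text \<open>\<open>E \<inter> C \<times> D = {}\<close> says that the strips over the complements of
  \<open>C\<close> and \<open>D\<close> cover \<open>E\<close>, so \<open>rectangle\<close> is the
  dual inequality for indicators. The locale extends it to bounded functions and derives a coupling
  that gives \<open>E\<close> mass at least \<open>1 - s\<close>.\<close>

locale rectangle_bound =
  \<mu>: prob_space \<mu> + \<nu>: prob_space \<nu> for \<mu> \<nu> :: "'a measure" +
  fixes F :: "'a measure" and E :: "('a \<times> 'a) set" and s :: real
  assumes sets_eq: "sets \<mu> = sets F" "sets \<nu> = sets F"
    and rectangle: "C \<in> sets F \<Longrightarrow> D \<in> sets F \<Longrightarrow> E \<inter> C \<times> D = {} \<Longrightarrow>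
      measure \<mu> C + measure \<nu> D \<le> 1 + s"
begin

lemma space_eq: "space \<mu> = space F" "space \<nu> = space F"
  using sets_eq by (auto dest: sets_eq_imp_space_eq)

lemma integrable_bounded:
  assumes "f \<in> bounded_measurable F"
  shows "integrable \<mu> f" "integrable \<nu> f"
proof -
  obtain c where c: "\<forall>x\<in>space F. \<bar>f x\<bar> \<le> c" and f: "f \<in> borel_measurable F"
    using assms by (auto simp: bounded_measurable_def)
  show "integrable \<mu> f"
    using c f by (intro \<mu>.integrable_const_bound[of _ c] AE_I2) (simp_all add: space_eq sets_eq cong: measurable_cong_sets)
  show "integrable \<nu> f"
    using c f by (intro \<nu>.integrable_const_bound[of _ c] AE_I2) (simp_all add: space_eq sets_eq cong: measurable_cong_sets)
qed

text \<open>Every level \<open>k / n\<close> turns the covering of \<open>E\<close> by \<open>f x + g y \<ge> 1\<close> into a covering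
  by the two strips \<open>f x \<ge> k / n\<close> and \<open>g y > 1 - k / n\<close>; averaging over \<open>k\<close> recovers the
  integrals up to \<open>1 / n\<close>.\<close>

lemma dual_bound_nonneg:
  assumes f: "f \<in> bounded_measurable F" "\<And>x. x \<in> space F \<Longrightarrow> 0 \<le> f x"
    and g: "g \<in> bounded_measurable F" "\<And>x. x \<in> space F \<Longrightarrow> 0 \<le> g x"
    and cover: "\<And>x y. x \<in> space F \<Longrightarrow> y \<in> space F \<Longrightarrow> (x, y) \<in> E \<Longrightarrow> 1 \<le> f x + g y"
  shows "1 - s \<le> (\<integral>x. f x \<partial>\<mu>) + (\<integral>y. g y \<partial>\<nu>)"
proof -
  let ?I = "(\<integral>x. f x \<partial>\<mu>) + (\<integral>y. g y \<partial>\<nu>)"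
  have bound: "1 - s \<le> ?I + 1 / real n" if n: "n > 0" for n :: nat
  proof -
    \<comment> \<open>Paired with \<open>B (n - Suc k)\<close>, the thresholds \<open>k + 1\<close>
      and \<open>n - (k + 1)\<close> add up to \<open>n\<close>. As one strip is defined by a weak
      and the other by a strict inequality, a point outside both has
      \<open>n * (f x + g y) < n\<close>.\<close>
    define A where "A k = {x \<in> space F. real k + 1 \<le> real n * f x}" for k :: nat
    define B where "B k = {y \<in> space F. real k < real n * g y}" for k :: nat
    have [measurable]: "f \<in> borel_measurable F" "g \<in> borel_measurable F"
      using f(1) g(1) by (simp_all add: bounded_measurable_def)
    have AF: "A k \<in> sets F" and BF: "B k \<in> sets F" for k
      unfolding A_def B_def by measurable
    have level: "1 - s \<le> measure \<mu> (A k) + measure \<nu> (B (n - Suc k))" if k: "k < n" for k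
    proof -
      have "False" if "(x, y) \<in> E" "x \<in> space F - A k" "y \<in> space F - B (n - Suc k)" for x y
      proof -
        have "real n * f x < real k + 1" "real n * g y \<le> real n - (real k + 1)"
          using that k by (auto simp: A_def B_def of_nat_diff)
        then have "real n * (f x + g y) < real n * 1" by (simp add: distrib_left)
        then have "f x + g y < 1" using n by (simp only: mult_less_cancel_left_pos of_nat_0_less_iff)
        then show False using cover[of x y] that by auto
      qed
      then have "measure \<mu> (space F - A k) + measure \<nu> (space F - B (n - Suc k)) \<le> 1 + s"
        by (intro rectangle sets.compl_sets AF BF) blast
      then show ?thesis
        using \<mu>.prob_compl[of "A k"] \<nu>.prob_compl[of "B (n - Suc k)"] AF BF
        by (simp add: sets_eq space_eq)
    qed
    have "real n * (1 - s) = (\<Sum>k<n. 1 - s)" by simp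
    also have "\<dots> \<le> (\<Sum>k<n. measure \<mu> (A k) + measure \<nu> (B (n - Suc k)))"
      by (intro sum_mono level) simp
    also have "\<dots> = (\<Sum>k<n. measure \<mu> (A k)) + (\<Sum>k<n. measure \<nu> (B k))"
      by (simp add: sum.distrib sum.nat_diff_reindex[of "\<lambda>k. measure \<nu> (B k)"])
    also have "(\<Sum>k<n. measure \<mu> (A k)) = (\<integral>x. (\<Sum>k<n. indicator (A k) x) \<partial>\<mu>)"
      using AF by (subst Bochner_Integration.integral_sum)
        (auto simp: sets_eq space_eq Int_absorb2 sets.sets_into_space intro!: integrable_bounded bounded_measurable_indicator)
    also have "\<dots> \<le> (\<integral>x. real n * f x \<partial>\<mu>)"
    proof (rule integral_mono)
      show "integrable \<mu> (\<lambda>x. \<Sum>k<n. indicator (A k) x :: real)"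
        by (intro Bochner_Integration.integrable_sum integrable_bounded bounded_measurable_indicator AF)
      show "integrable \<mu> (\<lambda>x. real n * f x)" by (intro integrable_bounded bounded_measurable_scale f)
      fix x assume "x \<in> space \<mu>"
      then show "(\<Sum>k<n. indicator (A k) x) \<le> real n * f x"
        using card_levels_le(1)[of "real n * f x" n] f(2)[of x] by (simp add: A_def indicator_def space_eq)
    qed
    also have "(\<Sum>k<n. measure \<nu> (B k)) = (\<integral>x. (\<Sum>k<n. indicator (B k) x) \<partial>\<nu>)"
      using BF by (subst Bochner_Integration.integral_sum)
        (auto simp: sets_eq space_eq Int_absorb2 sets.sets_into_space intro!: integrable_bounded bounded_measurable_indicator)
    also have "\<dots> \<le> (\<integral>x. real n * g x + 1 \<partial>\<nu>)"
    proof (rule integral_mono)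
      show "integrable \<nu> (\<lambda>x. \<Sum>k<n. indicator (B k) x :: real)"
        by (intro Bochner_Integration.integrable_sum integrable_bounded bounded_measurable_indicator BF)
      show "integrable \<nu> (\<lambda>x. real n * g x + 1)"
        by (intro integrable_bounded bounded_measurable_add bounded_measurable_scale bounded_measurable_const g)
      fix x assume "x \<in> space \<nu>"
      then show "(\<Sum>k<n. indicator (B k) x) \<le> real n * g x + 1"
        using card_levels_le(2)[of "real n * g x" n] g(2)[of x] by (simp add: B_def indicator_def space_eq)
    qed
    also have "(\<integral>x. real n * g x + 1 \<partial>\<nu>) = real n * (\<integral>y. g y \<partial>\<nu>) + 1"
      using integrable_bounded[OF g(1)] by (simp add: \<nu>.prob_space)
    finally have "real n * (1 - s) \<le> real n * (?I + 1 / real n)"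
      using n by (simp add: algebra_simps)
    then show ?thesis using n by (simp only: mult_le_cancel_left_pos of_nat_0_less_iff)
  qed
  show ?thesis
  proof (rule field_le_epsilon)
    fix e :: real assume "e > 0"
    then obtain n where "inverse (real (Suc n)) < e" using reals_Archimedean by blast
    then show "1 - s \<le> ?I + e" using bound[of "Suc n"] by (simp add: inverse_eq_divide)
  qed
qed

text \<open>Moving a constant from \<open>f\<close> to \<open>g\<close> changes neither the covering
  nor the sum of the integrals, as both measures are probabilities. Since
  \<open>f x + g y \<ge> 0\<close> on the square, moving the infimum of \<open>f\<close> makes both
  parts nonnegative; division by \<open>t\<close> does the rest.\<close>

lemma dual_bound:
  assumes f: "f \<in> bounded_measurable F" and g: "g \<in> bounded_measurable F" and t: "t \<ge> 0"
    and cover: "\<And>x y. x \<in> space F \<Longrightarrow> y \<in> space F \<Longrightarrow> t * indicator E (x, y) \<le> f x + g y"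
  shows "t * (1 - s) \<le> (\<integral>x. f x \<partial>\<mu>) + (\<integral>y. g y \<partial>\<nu>)"
proof -
  define a where "a = (INF x\<in>space F. f x)"
  have ne: "space F \<noteq> {}" using \<mu>.not_empty by (simp add: space_eq)
  obtain c where "\<forall>x\<in>space F. \<bar>f x\<bar> \<le> c" using f by (auto simp: bounded_measurable_def)
  then have "bdd_below (f ` space F)" by (intro bdd_belowI2[of _ "- c"]) force
  then have fa: "0 \<le> f x + - a" if "x \<in> space F" for x
    using that unfolding a_def by (simp add: cINF_lower)
  have ga: "0 \<le> g y + a" if y: "y \<in> space F" for y
  proof -
    have "- g y \<le> f x" if "x \<in> space F" for x
    proof -
      have "0 \<le> t * indicator E (x, y)" using t by simp
      also have "\<dots> \<le> f x + g y" by (rule cover[OF that y])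
      finally show ?thesis by simp
    qed
    then have "- g y \<le> a" unfolding a_def by (intro cINF_greatest ne)
    then show ?thesis by simp
  qed
  have fa_bm: "(\<lambda>x. f x + - a) \<in> bounded_measurable F" and ga_bm: "(\<lambda>y. g y + a) \<in> bounded_measurable F"
    by (intro bounded_measurable_add bounded_measurable_const f g)+
  have int: "(\<integral>x. f x + - a \<partial>\<mu>) + (\<integral>y. g y + a \<partial>\<nu>) = (\<integral>x. f x \<partial>\<mu>) + (\<integral>y. g y \<partial>\<nu>)"
    using integrable_bounded(1)[OF f] integrable_bounded(2)[OF g] by (simp add: \<mu>.prob_space \<nu>.prob_space)
  show ?thesis
  \<comment> \<open>For \<open>t = 0\<close> there is nothing to divide by, but the claim is then
    mere nonnegativity.\<close>
  proof (cases "t = 0")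
    case True
    have "0 \<le> (\<integral>x. f x + - a \<partial>\<mu>)" "0 \<le> (\<integral>y. g y + a \<partial>\<nu>)"
      using fa ga by (auto intro!: Bochner_Integration.integral_nonneg simp: space_eq simp del: add_uminus_conv_diff)
    then show ?thesis using int True by simp
  next
    case False
    then have t0: "t > 0" using t by simp
    have "1 - s \<le> (\<integral>x. (1 / t) * (f x + - a) \<partial>\<mu>) + (\<integral>y. (1 / t) * (g y + a) \<partial>\<nu>)"
    proof (rule dual_bound_nonneg)
      fix x y assume xy: "x \<in> space F" "y \<in> space F" "(x, y) \<in> E"
      then have "t \<le> f x + g y" using cover[of x y] by simp
      then show "1 \<le> (1 / t) * (f x + - a) + (1 / t) * (g y + a)"
        using t0 by (simp flip: add_divide_distrib diff_divide_distrib)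
    next
      show "(\<lambda>x. (1 / t) * (f x + - a)) \<in> bounded_measurable F" "(\<lambda>y. (1 / t) * (g y + a)) \<in> bounded_measurable F"
        by (rule bounded_measurable_scale[OF fa_bm], rule bounded_measurable_scale[OF ga_bm])
    qed (use fa ga t0 in \<open>simp_all\<close>)
    also have "\<dots> = (1 / t) * ((\<integral>x. f x \<partial>\<mu>) + (\<integral>y. g y \<partial>\<nu>))"
      unfolding int[symmetric] integral_mult_right_zero by (rule distrib_left[symmetric])
    finally show ?thesis using t0 by (simp add: field_simps)
  qed
qed

text \<open>For bounded measurable \<open>h\<close>, every coupling with
  \<open>P E \<ge> 1 - s\<close> integrates \<open>h\<close> to at most each of these numbers;
  \<open>t\<close> is the multiplier of that constraint. So \<open>Inf (cost h)\<close> is the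
  natural upper bound to impose on the functional sought.\<close>

definition cost :: "(('a \<times> 'a) \<Rightarrow> real) \<Rightarrow> real set" where
  "cost h = {(\<integral>x. f x \<partial>\<mu>) + (\<integral>y. g y \<partial>\<nu>) - t * (1 - s) | f g t.
     f \<in> bounded_measurable F \<and> g \<in> bounded_measurable F \<and> t \<ge> 0 \<and>
     (\<forall>x\<in>space F. \<forall>y\<in>space F. h (x, y) \<le> f x + g y - t * indicator E (x, y))}"

lemma costI:
  assumes "f \<in> bounded_measurable F" "g \<in> bounded_measurable F" "t \<ge> 0"
    "\<And>x y. x \<in> space F \<Longrightarrow> y \<in> space F \<Longrightarrow> h (x, y) \<le> f x + g y - t * indicator E (x, y)"
  shows "(\<integral>x. f x \<partial>\<mu>) + (\<integral>y. g y \<partial>\<nu>) - t * (1 - s) \<in> cost h"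
  unfolding cost_def using assms by blast

lemma costE:
  assumes "r \<in> cost h"
  obtains f g t where "f \<in> bounded_measurable F" "g \<in> bounded_measurable F" "t \<ge> 0"
    "\<And>x y. x \<in> space F \<Longrightarrow> y \<in> space F \<Longrightarrow> h (x, y) \<le> f x + g y - t * indicator E (x, y)"
    "r = (\<integral>x. f x \<partial>\<mu>) + (\<integral>y. g y \<partial>\<nu>) - t * (1 - s)"
  using assms unfolding cost_def by blast

text \<open>The constant \<open>c\<close> is absorbed into \<open>f\<close>. Through
  \<open>dual_bound\<close> the rectangle hypothesis enters here, and it is what makes
  \<open>Inf (cost h)\<close> a genuine infimum.\<close>

lemma cost_lower:
  assumes r: "r \<in> cost h" and h: "\<And>z. - c \<le> h z"
  shows "- c \<le> r"
proof -
  obtain f g t where *: "f \<in> bounded_measurable F" "g \<in> bounded_measurable F" "t \<ge> 0"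
    "\<And>x y. x \<in> space F \<Longrightarrow> y \<in> space F \<Longrightarrow> h (x, y) \<le> f x + g y - t * indicator E (x, y)"
    "r = (\<integral>x. f x \<partial>\<mu>) + (\<integral>y. g y \<partial>\<nu>) - t * (1 - s)"
    using costE[OF r] by blast
  have "t * (1 - s) \<le> (\<integral>x. f x + c \<partial>\<mu>) + (\<integral>y. g y \<partial>\<nu>)"
  proof (rule dual_bound)
    fix x y assume "x \<in> space F" "y \<in> space F"
    then show "t * indicator E (x, y) \<le> f x + c + g y" using *(4)[of x y] h[of "(x, y)"] by linarith
  qed (use * in \<open>auto intro: bounded_measurable_add bounded_measurable_const\<close>)
  also have "(\<integral>x. f x + c \<partial>\<mu>) = (\<integral>x. f x \<partial>\<mu>) + c"
    using integrable_bounded(1)[OF *(1)] by (simp add: \<mu>.prob_space)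
  finally show ?thesis using *(5) by simp
qed

text \<open>Measurable or not: every indicator belongs, so the functional gives a number to every
  set of pairs.\<close>

abbreviation bounded_functions :: "(('a \<times> 'a) \<Rightarrow> real) set" where
  "bounded_functions \<equiv> {h. \<exists>c. \<forall>z. \<bar>h z\<bar> \<le> c}"

lemma function_space_bounded: "function_space bounded_functions"
proof
  fix f g :: "('a \<times> 'a) \<Rightarrow> real" and c :: real
  assume "f \<in> bounded_functions"
  then obtain b where b: "\<And>z. \<bar>f z\<bar> \<le> b" by blast
  have "\<bar>c * f z\<bar> \<le> \<bar>c\<bar> * b" for z using b[of z] by (simp add: abs_mult mult_left_mono)
  then show "(\<lambda>x. c * f x) \<in> bounded_functions" by blast
  assume "g \<in> bounded_functions"
  then obtain d where d: "\<And>z. \<bar>g z\<bar> \<le> d" by blast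
  have "\<bar>f z + g z\<bar> \<le> b + d" for z using b[of z] d[of z] by linarith
  then show "(\<lambda>x. f x + g x) \<in> bounded_functions" by blast
qed auto

lemma cost_bdd_below: "h \<in> bounded_functions \<Longrightarrow> bdd_below (cost h)"
proof -
  assume "h \<in> bounded_functions"
  then obtain c where c: "\<And>z. \<bar>h z\<bar> \<le> c" by blast
  have "- c \<le> h z" for z using c[of z] by linarith
  then show ?thesis using cost_lower by (meson bdd_belowI)
qed

lemma cost_nonempty: "h \<in> bounded_functions \<Longrightarrow> cost h \<noteq> {}"
proof -
  assume "h \<in> bounded_functions"
  then obtain c where c: "\<And>z. \<bar>h z\<bar> \<le> c" by blast
  have "h (x, y) \<le> c + 0 - 0 * indicator E (x, y)" for x y using c[of "(x, y)"] by simp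
  then show ?thesis
    using costI[of "\<lambda>_. c" "\<lambda>_. 0" 0 h] bounded_measurable_const by blast
qed

text \<open>The triples \<open>f\<close>, \<open>g\<close>, \<open>t\<close> form a convex cone on
  which the price is linear; bounds for \<open>h\<close> and \<open>k\<close> add up to a bound for
  the sum, and positive multiples bound multiples.\<close>

lemma sublinear_Inf_cost: "sublinear_on bounded_functions (\<lambda>h. Inf (cost h))"
proof -
  interpret function_space bounded_functions by (rule function_space_bounded)
  show ?thesis
    unfolding sublinear_on_def
  proof (intro conjI ballI allI impI)
    fix h k assume hk: "h \<in> bounded_functions" "k \<in> bounded_functions"
    have *: "Inf (cost (\<lambda>z. h z + k z)) \<le> r + q" if r: "r \<in> cost h" and q: "q \<in> cost k" for r q
    proof -
      obtain f g t where 1: "f \<in> bounded_measurable F" "g \<in> bounded_measurable F" "t \<ge> 0"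
        "\<And>x y. x \<in> space F \<Longrightarrow> y \<in> space F \<Longrightarrow> h (x, y) \<le> f x + g y - t * indicator E (x, y)"
        "r = (\<integral>x. f x \<partial>\<mu>) + (\<integral>y. g y \<partial>\<nu>) - t * (1 - s)"
        using costE[OF r] by blast
      obtain f' g' t' where 2: "f' \<in> bounded_measurable F" "g' \<in> bounded_measurable F" "t' \<ge> 0"
        "\<And>x y. x \<in> space F \<Longrightarrow> y \<in> space F \<Longrightarrow> k (x, y) \<le> f' x + g' y - t' * indicator E (x, y)"
        "q = (\<integral>x. f' x \<partial>\<mu>) + (\<integral>y. g' y \<partial>\<nu>) - t' * (1 - s)"
        using costE[OF q] by blast
      have "(\<integral>x. f x + f' x \<partial>\<mu>) + (\<integral>y. g y + g' y \<partial>\<nu>) - (t + t') * (1 - s) \<in> cost (\<lambda>z. h z + k z)"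
      proof (rule costI)
        fix x y assume "x \<in> space F" "y \<in> space F"
        then show "h (x, y) + k (x, y) \<le> f x + f' x + (g y + g' y) - (t + t') * indicator E (x, y)"
          using 1(4)[of x y] 2(4)[of x y] by (simp add: distrib_right)
      qed (use 1 2 in \<open>auto intro: bounded_measurable_add\<close>)
      moreover have "(\<integral>x. f x + f' x \<partial>\<mu>) + (\<integral>y. g y + g' y \<partial>\<nu>) - (t + t') * (1 - s) = r + q"
        using 1 2 by (simp add: integrable_bounded algebra_simps)
      ultimately show ?thesis using cInf_lower[OF _ cost_bdd_below[OF add[OF hk]]] by simp
    qed
    have "Inf (cost (\<lambda>z. h z + k z)) - q \<le> Inf (cost h)" if "q \<in> cost k" for q
      using *[OF _ that] by (intro cInf_greatest cost_nonempty hk) (simp add: algebra_simps)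
    then have "Inf (cost (\<lambda>z. h z + k z)) - Inf (cost h) \<le> Inf (cost k)"
      by (intro cInf_greatest cost_nonempty hk) (simp add: algebra_simps)
    then show "Inf (cost (\<lambda>z. h z + k z)) \<le> Inf (cost h) + Inf (cost k)" by simp
  next
    fix h and c :: real assume h: "h \<in> bounded_functions" and c: "c > 0"
    have "Inf (cost (\<lambda>z. c * h z)) / c \<le> r" if r: "r \<in> cost h" for r
    proof -
      obtain f g t where 1: "f \<in> bounded_measurable F" "g \<in> bounded_measurable F" "t \<ge> 0"
        "\<And>x y. x \<in> space F \<Longrightarrow> y \<in> space F \<Longrightarrow> h (x, y) \<le> f x + g y - t * indicator E (x, y)"
        "r = (\<integral>x. f x \<partial>\<mu>) + (\<integral>y. g y \<partial>\<nu>) - t * (1 - s)"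
        using costE[OF r] by blast
      have "(\<integral>x. c * f x \<partial>\<mu>) + (\<integral>y. c * g y \<partial>\<nu>) - (c * t) * (1 - s) \<in> cost (\<lambda>z. c * h z)"
      proof (rule costI)
        fix x y assume "x \<in> space F" "y \<in> space F"
        then have "c * h (x, y) \<le> c * (f x + g y - t * indicator E (x, y))"
          using 1(4)[of x y] c by (intro mult_left_mono) auto
        then show "c * h (x, y) \<le> c * f x + c * g y - (c * t) * indicator E (x, y)"
          by (simp add: right_diff_distrib distrib_left mult.assoc)
      qed (use 1 c in \<open>auto intro: bounded_measurable_scale\<close>)
      moreover have "(\<integral>x. c * f x \<partial>\<mu>) + (\<integral>y. c * g y \<partial>\<nu>) - (c * t) * (1 - s) = c * r"
        unfolding 1(5) by (simp add: algebra_simps)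
      ultimately have "Inf (cost (\<lambda>z. c * h z)) \<le> c * r"
        using cInf_lower[OF _ cost_bdd_below[OF scale[OF h]]] by simp
      then show ?thesis using c by (simp add: pos_divide_le_eq mult.commute)
    qed
    then have "Inf (cost (\<lambda>z. c * h z)) / c \<le> Inf (cost h)" by (intro cInf_greatest cost_nonempty h)
    then show "Inf (cost (\<lambda>z. c * h z)) \<le> c * Inf (cost h)"
      using c by (simp add: pos_divide_le_eq mult.commute)
  qed
qed

text \<open>Additivity of \<open>P\<close> is that of \<open>L\<close>. Everything else is read off
  from \<open>L \<le> Inf (cost _)\<close> by an explicit bound on an indicator or its negative;
  testing both signs pins the marginals down exactly.\<close>

proposition fin_additive_coupling_exists: "\<exists>P\<in>fin_additive_couplings F \<mu> \<nu>. 1 - P E \<le> s"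
proof -
  interpret function_space bounded_functions by (rule function_space_bounded)
  obtain L where L_add: "\<And>f g. f \<in> bounded_functions \<Longrightarrow> g \<in> bounded_functions \<Longrightarrow> L (\<lambda>x. f x + g x) = L f + L g"
    and L_le: "\<And>f. f \<in> bounded_functions \<Longrightarrow> L f \<le> Inf (cost f)"
    and L_minus: "\<And>f. f \<in> bounded_functions \<Longrightarrow> L (\<lambda>x. - f x) = - L f"
    using Hahn_Banach[OF sublinear_Inf_cost] by blast
  define P where "P A = L (indicator A)" for A
  have ind: "indicator A \<in> bounded_functions" for A
    by (auto simp: indicator_def intro!: exI[of _ 1])
  have upper: "L h \<le> (\<integral>x. f x \<partial>\<mu>) + (\<integral>y. g y \<partial>\<nu>) - t * (1 - s)"
    if "h \<in> bounded_functions" "f \<in> bounded_measurable F" "g \<in> bounded_measurable F" "t \<ge> 0"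
      "\<And>x y. x \<in> space F \<Longrightarrow> y \<in> space F \<Longrightarrow> h (x, y) \<le> f x + g y - t * indicator E (x, y)" for h f g t
    using L_le[OF that(1)] cInf_lower[OF costI[OF that(2-5)] cost_bdd_below[OF that(1)]] by linarith
  have P_le: "P A \<le> (\<integral>x. f x \<partial>\<mu>) + (\<integral>y. g y \<partial>\<nu>) - t * (1 - s)"
    if "f \<in> bounded_measurable F" "g \<in> bounded_measurable F" "t \<ge> 0"
      "\<And>x y. x \<in> space F \<Longrightarrow> y \<in> space F \<Longrightarrow> indicator A (x, y) \<le> f x + g y - t * indicator E (x, y)" for A f g t
    unfolding P_def by (rule upper[OF ind that])
  have P_ge: "- P A \<le> (\<integral>x. f x \<partial>\<mu>) + (\<integral>y. g y \<partial>\<nu>) - t * (1 - s)"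
    if "f \<in> bounded_measurable F" "g \<in> bounded_measurable F" "t \<ge> 0"
      "\<And>x y. x \<in> space F \<Longrightarrow> y \<in> space F \<Longrightarrow> - indicator A (x, y) \<le> f x + g y - t * indicator E (x, y)" for A f g t
    unfolding P_def L_minus[OF ind, symmetric] by (rule upper[OF uminus[OF ind] that])
  have nonneg: "0 \<le> P A" for A
    using P_ge[of "\<lambda>_. 0" "\<lambda>_. 0" 0 A] by (simp add: bounded_measurable_const)
  have minus_ind: "(\<lambda>x. - indicator A x) \<in> bounded_measurable F" if "A \<in> sets F" for A
    using bounded_measurable_scale[OF bounded_measurable_indicator[OF that], of "-1"] by simp
  have marg1: "P (A \<times> space F) = measure \<mu> A" if A: "A \<in> sets F" for A
  proof (rule antisym)
    have "A \<inter> space \<mu> = A" using sets.sets_into_space[OF A] by (auto simp: space_eq)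
    then show "P (A \<times> space F) \<le> measure \<mu> A" "measure \<mu> A \<le> P (A \<times> space F)"
      using P_le[of "indicator A" "\<lambda>_. 0" 0 "A \<times> space F"] P_ge[of "\<lambda>x. - indicator A x" "\<lambda>_. 0" 0 "A \<times> space F"]
        bounded_measurable_indicator[OF A] minus_ind[OF A]
      by (simp_all add: indicator_times bounded_measurable_const)
  qed
  have marg2: "P (space F \<times> A) = measure \<nu> A" if A: "A \<in> sets F" for A
  proof (rule antisym)
    have "A \<inter> space \<nu> = A" using sets.sets_into_space[OF A] by (auto simp: space_eq)
    then show "P (space F \<times> A) \<le> measure \<nu> A" "measure \<nu> A \<le> P (space F \<times> A)"
      using P_le[of "\<lambda>_. 0" "indicator A" 0 "space F \<times> A"] P_ge[of "\<lambda>_. 0" "\<lambda>x. - indicator A x" 0 "space F \<times> A"]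
        bounded_measurable_indicator[OF A] minus_ind[OF A]
      by (simp_all add: indicator_times bounded_measurable_const)
  qed
  have "additive (sets (F \<Otimes>\<^sub>M F)) P"
    unfolding additive_def
  proof (intro ballI impI)
    fix A B :: "('a \<times> 'a) set" assume "A \<inter> B = {}"
    then have "indicator (A \<union> B) = (\<lambda>z. indicator A z + indicator B z :: real)"
      by (intro ext) (auto simp: indicator_def)
    then show "P (A \<union> B) = P A + P B" unfolding P_def using L_add[OF ind ind] by simp
  qed
  moreover have "P (space (F \<Otimes>\<^sub>M F)) = 1"
    using marg1[OF sets.top] \<mu>.prob_space by (simp add: space_pair_measure space_eq)
  ultimately have "P \<in> fin_additive_couplings F \<mu> \<nu>"
    using nonneg marg1 marg2 by (simp add: fin_additive_couplings_def fin_additive_prob_def)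
  \<comment> \<open>With \<open>f = g = 0\<close> and \<open>t = 1\<close> the bound on
    \<open>- indicator E\<close> is an equality and costs \<open>s - 1\<close>.\<close>
  moreover have "1 - P E \<le> s"
    using P_ge[of "\<lambda>_. 0" "\<lambda>_. 0" 1 E] by (simp add: bounded_measurable_const)
  ultimately show ?thesis by blast
qed

end

section \<open>Duality\<close>

lemma fin_additive_prob_mono:
  assumes P: "fin_additive_prob N P" and AB: "A \<in> sets N" "B \<in> sets N" "A \<subseteq> B"
  shows "P A \<le> P B"
proof -
  have "P (A \<union> (B - A)) = P A + P (B - A)"
    using P AB unfolding fin_additive_prob_def additive_def by blast
  moreover have "0 \<le> P (B - A)" using P AB by (simp add: fin_additive_prob_def)
  moreover have "A \<union> (B - A) = B" using AB by blast
  ultimately show ?thesis by simp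
qed

text \<open>The easy half of duality: \<open>E\<close> and \<open>C \<times> (space F - D)\<close>
  are disjoint, so their masses sum to at most one, and the rectangle has mass at least
  \<open>measure \<mu> C - measure \<nu> D\<close>.\<close>

lemma coupling_rectangle_le:
  assumes P: "P \<in> fin_additive_couplings F \<mu> \<nu>"
    and E: "E \<in> sets (F \<Otimes>\<^sub>M F)" and CD: "C \<in> sets F" "D \<in> sets F"
    and sep: "E \<inter> C \<times> (space F - D) = {}"
  shows "measure \<mu> C - measure \<nu> D \<le> 1 - P E"
proof -
  let ?N = "F \<Otimes>\<^sub>M F"
  let ?R = "C \<times> (space F - D)"
  have fin: "fin_additive_prob ?N P"
    and marg: "P (C \<times> space F) = measure \<mu> C" "P (space F \<times> D) = measure \<nu> D"
    using P CD by (auto simp: fin_additive_couplings_def)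
  have add: "P (A \<union> B) = P A + P B" if "A \<in> sets ?N" "B \<in> sets ?N" "A \<inter> B = {}" for A B
    using fin that by (simp add: fin_additive_prob_def additive_def)
  have R: "?R \<in> sets ?N" and CD_N: "C \<times> D \<in> sets ?N" "space F \<times> D \<in> sets ?N"
    using CD by auto
  have "P (E \<union> ?R) \<le> P (space ?N)"
    using E R by (intro fin_additive_prob_mono[OF fin] sets.Un sets.top sets.sets_into_space)
  then have "P E + P ?R \<le> 1"
    using add[OF E R sep] fin by (simp add: fin_additive_prob_def)
  moreover have "P (C \<times> space F) = P ?R + P (C \<times> D)"
  proof -
    have "C \<times> space F = ?R \<union> C \<times> D" using sets.sets_into_space[OF CD(2)] by blast
    then show ?thesis using add[OF R CD_N(1)] by auto
  qed
  moreover have "P (C \<times> D) \<le> P (space F \<times> D)"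
    using sets.sets_into_space[OF CD(1)] by (intro fin_additive_prob_mono[OF fin CD_N]) blast
  ultimately show ?thesis using marg by linarith
qed

text \<open>Couplings are controlled on the product sigma-field only, so sets of the completion have
  to be replaced by measurable ones. Dropping the null part, or adding a measurable null set that
  covers it, changes no measure.\<close>

lemma (in prob_space) completion_sandwich:
  assumes "A \<in> sets (completion M)"
  obtains C D where "C \<in> sets M" "D \<in> sets M" "C \<subseteq> A" "A \<subseteq> D"
    "prob C = measure (completion M) A" "prob D = measure (completion M) A"
proof -
  obtain C N N' where C: "A = C \<union> N" "N \<subseteq> N'" "N' \<in> null_sets M" "C \<in> sets M"
    using sets_completionE[OF assms] by blast
  interpret c: prob_space "completion M" by (rule prob_space_completion)
  have N': "prob (C \<union> N') = prob C" using C by (intro measure_Un_null_set)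
  have "c.prob C \<le> c.prob A" using C assms by (intro c.finite_measure_mono) auto
  moreover have "c.prob A \<le> c.prob (C \<union> N')" using C by (intro c.finite_measure_mono) auto
  moreover have "C \<union> N' \<in> sets M" using C by auto
  ultimately have "c.prob A = prob C" using N' C(4) by simp
  moreover note N'
  ultimately show ?thesis using that[of C "C \<union> N'"] C by auto
qed

text \<open>The inner approximation is taken for \<mu> and the outer one for \<nu>, so
  \<open>C \<subseteq> A \<subseteq> D\<close>. Invariance of \<open>A\<close> keeps
  \<open>E\<close> away from \<open>C \<times> (space F - D)\<close>, although \<open>C\<close> and
  \<open>D\<close> themselves may fail to be invariant.\<close>

lemma invariant_sets_le:
  assumes \<mu>: "\<mu> \<in> space (prob_algebra F)" and \<nu>: "\<nu> \<in> space (prob_algebra F)"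
    and P: "P \<in> fin_additive_couplings F \<mu> \<nu>"
    and E: "measurable_equivalence F E" and A: "A \<in> invariant_sets F E"
  shows "measure (completion \<mu>) A - measure (completion \<nu>) A \<le> 1 - P E"
proof -
  interpret \<mu>: prob_space \<mu> using \<mu> by (simp add: space_prob_algebra)
  interpret \<nu>: prob_space \<nu> using \<nu> by (simp add: space_prob_algebra)
  have sets: "sets \<mu> = sets F" "sets \<nu> = sets F" using \<mu> \<nu> by (auto simp: space_prob_algebra)
  have AU: "A \<in> sets (completion \<mu>)" "A \<in> sets (completion \<nu>)"
    using A \<mu> \<nu> by (auto simp: invariant_sets_def universally_measurable_def)
  obtain C where C: "C \<in> sets F" "C \<subseteq> A" "measure \<mu> C = measure (completion \<mu>) A"
    using \<mu>.completion_sandwich[OF AU(1)] sets by metis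
  obtain D where D: "D \<in> sets F" "A \<subseteq> D" "measure \<nu> D = measure (completion \<nu>) A"
    using \<nu>.completion_sandwich[OF AU(2)] sets by metis
  have "E \<inter> C \<times> (space F - D) = {}"
    using A C(2) D(2) by (auto simp: invariant_sets_def)
  then show ?thesis
    using coupling_rectangle_le[OF P _ C(1) D(1)] E C(3) D(3) by (simp add: measurable_equivalence_def)
qed

text \<open>Complements of invariant sets are invariant and reverse the sign of the
  difference.\<close>

lemma invariant_sets_abs_le:
  assumes \<mu>: "\<mu> \<in> space (prob_algebra F)" and \<nu>: "\<nu> \<in> space (prob_algebra F)"
    and P: "P \<in> fin_additive_couplings F \<mu> \<nu>"
    and E: "measurable_equivalence F E" and A: "A \<in> invariant_sets F E"
  shows "\<bar>measure (completion \<mu>) A - measure (completion \<nu>) A\<bar> \<le> 1 - P E"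
proof -
  interpret \<mu>: prob_space \<mu> using \<mu> by (simp add: space_prob_algebra)
  interpret \<nu>: prob_space \<nu> using \<nu> by (simp add: space_prob_algebra)
  have sets: "sets \<mu> = sets F" "sets \<nu> = sets F" using \<mu> \<nu> by (auto simp: space_prob_algebra)
  have sp: "space \<mu> = space F" "space \<nu> = space F" using sets by (auto dest: sets_eq_imp_space_eq)
  interpret \<mu>c: prob_space "completion \<mu>" by (rule \<mu>.prob_space_completion)
  interpret \<nu>c: prob_space "completion \<nu>" by (rule \<nu>.prob_space_completion)
  have E_sub: "E \<subseteq> space F \<times> space F" using E sets.sets_into_space
    by (fastforce simp: measurable_equivalence_def space_pair_measure)
  have AU: "A \<in> sets (completion \<mu>)" "A \<in> sets (completion \<nu>)"
    using A \<mu> \<nu> by (auto simp: invariant_sets_def universally_measurable_def)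
  have "space F - A \<in> sets (completion \<rho>)" if \<rho>: "\<rho> \<in> space (prob_algebra F)" for \<rho>
  proof -
    have "space (completion \<rho>) = space F" using \<rho> by (auto simp: space_prob_algebra dest: sets_eq_imp_space_eq)
    moreover have "A \<in> sets (completion \<rho>)"
      using A \<rho> by (simp add: invariant_sets_def universally_measurable_def)
    ultimately show ?thesis using sets.compl_sets by metis
  qed
  then have "space F - A \<in> invariant_sets F E"
    using A E_sub by (auto simp: invariant_sets_def universally_measurable_def)
  from invariant_sets_le[OF \<mu> \<nu> P E this] invariant_sets_le[OF \<mu> \<nu> P E A]
  show ?thesis using \<mu>c.prob_compl[OF AU(1)] \<nu>c.prob_compl[OF AU(2)] by (simp add: sp)
qed

lemma invariant_sets_on_space_subset:
  assumes "measurable_equivalence F E"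
  shows "invariant_sets_on F E (space F) \<subseteq> invariant_sets F E"
proof
  fix A assume A: "A \<in> invariant_sets_on F E (space F)"
  have "E \<subseteq> space F \<times> space F" using assms sets.sets_into_space
    by (fastforce simp: measurable_equivalence_def space_pair_measure)
  then have "\<forall>(x, y)\<in>E. x \<in> A \<longleftrightarrow> y \<in> A" "A \<in> sets F"
    using A by (auto simp: invariant_sets_on_def)
  then show "A \<in> invariant_sets F E"
    using sets.sets_into_space[of A F]
    by (auto simp: invariant_sets_def universally_measurable_def space_prob_algebra)
qed

text \<open>The lower inclusion puts the separating Borel sets into \<open>G\<close>, making the
  supremum large enough for a coupling to exist; the upper inclusion makes every coupling cost at
  least the supremum. Equality and attainment follow together.\<close>

lemma optimal_coupling:
  assumes F: "standard_borel F" and E: "measurable_equivalence F E"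
    and \<mu>: "\<mu> \<in> space (prob_algebra F)" and \<nu>: "\<nu> \<in> space (prob_algebra F)"
    and G: "invariant_sets_on F E (space F) \<subseteq> G" "G \<subseteq> invariant_sets F E"
  shows "\<exists>P. is_arg_min (\<lambda>P. 1 - P E) (\<lambda>P. P \<in> fin_additive_couplings F \<mu> \<nu>) P \<and>
             1 - P E = sup_dist G \<mu> \<nu>"
proof -
  interpret \<mu>: prob_space \<mu> using \<mu> by (simp add: space_prob_algebra)
  interpret \<nu>: prob_space \<nu> using \<nu> by (simp add: space_prob_algebra)
  have sets: "sets \<mu> = sets F" "sets \<nu> = sets F" using \<mu> \<nu> by (auto simp: space_prob_algebra)
  have sp: "space \<mu> = space F" "space \<nu> = space F" using sets by (auto dest: sets_eq_imp_space_eq)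
  interpret \<mu>c: prob_space "completion \<mu>" by (rule \<mu>.prob_space_completion)
  interpret \<nu>c: prob_space "completion \<nu>" by (rule \<nu>.prob_space_completion)
  let ?d = "\<lambda>A. \<bar>measure (completion \<mu>) A - measure (completion \<nu>) A\<bar>"
  have bdd: "bdd_above (?d ` G)"
    by (intro bdd_aboveI2[of _ _ 1]) (smt (verit) \<mu>c.prob_le_1 \<nu>c.prob_le_1 measure_nonneg)
  interpret rectangle_bound \<mu> \<nu> F E "sup_dist G \<mu> \<nu>"
  proof
    fix C D assume CD: "C \<in> sets F" "D \<in> sets F" "E \<inter> C \<times> D = {}"
    obtain A where A: "A \<in> invariant_sets_on F E (space F)" "C \<subseteq> A" "A \<inter> D = {}"
      by (rule invariant_separation[OF F E CD])
    then have AF: "A \<in> sets F" by (simp add: invariant_sets_on_def)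
    have "measure \<mu> C \<le> measure \<mu> A" using A AF sets by (intro \<mu>.finite_measure_mono) auto
    moreover have "measure \<nu> D \<le> measure \<nu> (space \<nu> - A)"
      using A AF CD sets.sets_into_space[OF CD(2)] sets by (intro \<nu>.finite_measure_mono) (auto simp: sp)
    moreover have "measure \<nu> (space \<nu> - A) = 1 - measure \<nu> A" using AF sets by (intro \<nu>.prob_compl) simp
    moreover have "?d A \<le> sup_dist G \<mu> \<nu>"
      unfolding sup_dist_def using A(1) G(1) by (intro cSUP_upper bdd) auto
    then have "measure \<mu> A - measure \<nu> A \<le> sup_dist G \<mu> \<nu>" using AF sets by simp
    ultimately show "measure \<mu> C + measure \<nu> D \<le> 1 + sup_dist G \<mu> \<nu>" by linarith
  qed (fact sets)+
  obtain P where P: "P \<in> fin_additive_couplings F \<mu> \<nu>" "1 - P E \<le> sup_dist G \<mu> \<nu>"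
    using fin_additive_coupling_exists by blast
  \<comment> \<open>Bounding the supremum from above needs a nonempty family.\<close>
  have "{} \<in> G" using G(1) by (auto simp: invariant_sets_on_def)
  then have lower: "sup_dist G \<mu> \<nu> \<le> 1 - Q E" if "Q \<in> fin_additive_couplings F \<mu> \<nu>" for Q
    unfolding sup_dist_def using invariant_sets_abs_le[OF \<mu> \<nu> that E] G(2)
    by (intro cSUP_least) auto
  have "1 - P E = sup_dist G \<mu> \<nu>" using P lower by (intro antisym) auto
  moreover have "is_arg_min (\<lambda>P. 1 - P E) (\<lambda>P. P \<in> fin_additive_couplings F \<mu> \<nu>) P"
    using P(1) lower calculation by (force simp: is_arg_min_def)
  ultimately show ?thesis by blast
qed

theorem theorem4:
  fixes F :: "'a measure" and E :: "('a \<times> 'a) set"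
  assumes "standard_borel F" and "measurable_equivalence F E"
  shows "(\<forall>\<mu>\<in>space (prob_algebra F). \<forall>\<nu>\<in>space (prob_algebra F).
            \<exists>P. is_arg_min (\<lambda>P. 1 - P E) (\<lambda>P. P \<in> fin_additive_couplings F \<mu> \<nu>) P \<and>
                1 - P E = sup_dist (invariant_sets F E) \<mu> \<nu>) \<and>
         (\<forall>\<mu>\<in>space (prob_algebra F). \<forall>\<nu>\<in>space (prob_algebra F).
            \<exists>B\<in>sets F. measure \<mu> B = 1 \<and> measure \<nu> B = 1 \<and>
              (\<exists>P. is_arg_min (\<lambda>P. 1 - P E) (\<lambda>P. P \<in> fin_additive_couplings F \<mu> \<nu>) P \<and>
                   1 - P E = sup_dist (invariant_sets_on F E B) \<mu> \<nu>))"
proof (intro conjI ballI)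
  fix \<mu> \<nu> assume \<mu>\<nu>: "\<mu> \<in> space (prob_algebra F)" "\<nu> \<in> space (prob_algebra F)"
  \<comment> \<open>The two claims are the two extreme choices of \<open>G\<close>.\<close>
  note opt = optimal_coupling[OF assms \<mu>\<nu>] and sub = invariant_sets_on_space_subset[OF assms(2)]
  show "\<exists>P. is_arg_min (\<lambda>P. 1 - P E) (\<lambda>P. P \<in> fin_additive_couplings F \<mu> \<nu>) P \<and>
      1 - P E = sup_dist (invariant_sets F E) \<mu> \<nu>"
    by (rule opt[OF sub order_refl])
  have "measure \<mu> (space F) = 1" "measure \<nu> (space F) = 1"
    using \<mu>\<nu> by (auto simp: space_prob_algebra dest!: sets_eq_imp_space_eq prob_space.prob_space)
  then show "\<exists>B\<in>sets F. measure \<mu> B = 1 \<and> measure \<nu> B = 1 \<and>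
      (\<exists>P. is_arg_min (\<lambda>P. 1 - P E) (\<lambda>P. P \<in> fin_additive_couplings F \<mu> \<nu>) P \<and>
        1 - P E = sup_dist (invariant_sets_on F E B) \<mu> \<nu>)"
    using opt[OF order_refl sub] by (intro bexI[of _ "space F"]) auto
qed

end
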